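(* Let $R$ be a finite commutative ring. If $\mathbf{k}$ is a left-noetherian ring then $\mathrm{Rep}_{\mathbf{k}}(\mathbf{VI}_R)$ and $\mathrm{Rep}_{\mathbf{k}}(\mathbf{VA}_R)$ are noetherian.
   Context: A linear map between free $R$-modules is splittable if its image is a direct summand (of the target). $\mathbf{VA}_R$ (resp. $\mathbf{VI}_R$) is the category whose objects are finite rank free $R$-modules and whose morphisms are the splittable maps (resp. the splittable injections). The ring $\mathbf{k}$ is nonzero and not necessarily commutative. $\mathrm{Rep}_{\mathbf{k}}(\mathcal{C})$ is the category of functors from $\mathcal{C}$ to left $\mathbf{k}$-modules, with natural transformations as morphisms. Such a functor $M$ is finitely generated if there is a finite set of elements (each in some $M(x)$) such that $M$ is the smallest subrepresentation containing them. $\mathrm{Rep}_{\mathbf{k}}(\mathcal{C})$ is noetherian if every subrepresentation of a finitely generated representation is finitely generated.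
   Formalization: For non-reduced R (e.g. Z/4) the splittable maps are not closed under composition, so VA_R is not literally a category; a representation of VA_R is here required to respect a composite of splittable maps only when that composite is itself splittable. *)

theory Defs
  imports "HOL-Algebra.Algebra" "HOL-Library.Infinite_Typeclass"
begin

section \<open>Left modules and left-noetherian rings\<close>

text \<open>The library's \<^locale>\<open>module\<close> requires a commutative ring of scalars. The following
  locale has the same module axioms over an arbitrary ring. As there, the fields \<open>mult\<close> and
  \<open>one\<close> of the module record carry no meaning.\<close>

locale left_module = R?: ring R + M?: abelian_group M
  for R :: "('k, 'd) ring_scheme" (structure) and M :: "('k, 'v, 'e) module_scheme" (structure) +
  assumes smult_closed [simp, intro]:
      "\<lbrakk>a \<in> carrier R; x \<in> carrier M\<rbrakk> \<Longrightarrow> a \<odot>\<^bsub>M\<^esub> x \<in> carrier M"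
    and smult_l_distr:
      "\<lbrakk>a \<in> carrier R; b \<in> carrier R; x \<in> carrier M\<rbrakk> \<Longrightarrow>
      (a \<oplus> b) \<odot>\<^bsub>M\<^esub> x = a \<odot>\<^bsub>M\<^esub> x \<oplus>\<^bsub>M\<^esub> b \<odot>\<^bsub>M\<^esub> x"
    and smult_r_distr:
      "\<lbrakk>a \<in> carrier R; x \<in> carrier M; y \<in> carrier M\<rbrakk> \<Longrightarrow>
      a \<odot>\<^bsub>M\<^esub> (x \<oplus>\<^bsub>M\<^esub> y) = a \<odot>\<^bsub>M\<^esub> x \<oplus>\<^bsub>M\<^esub> a \<odot>\<^bsub>M\<^esub> y"
    and smult_assoc1:
      "\<lbrakk>a \<in> carrier R; b \<in> carrier R; x \<in> carrier M\<rbrakk> \<Longrightarrow>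
      (a \<otimes> b) \<odot>\<^bsub>M\<^esub> x = a \<odot>\<^bsub>M\<^esub> (b \<odot>\<^bsub>M\<^esub> x)"
    and smult_one [simp]: "x \<in> carrier M \<Longrightarrow> \<one> \<odot>\<^bsub>M\<^esub> x = x"

definition linear_map ::
    "('r, 'd) ring_scheme \<Rightarrow> ('r, 'u) module \<Rightarrow> ('r, 'v) module \<Rightarrow> ('u \<Rightarrow> 'v) \<Rightarrow> bool" where
  "linear_map R V W f \<longleftrightarrow>
     f \<in> carrier V \<rightarrow> carrier W \<and>
     (\<forall>x\<in>carrier V. \<forall>y\<in>carrier V. f (x \<oplus>\<^bsub>V\<^esub> y) = f x \<oplus>\<^bsub>W\<^esub> f y) \<and>
     (\<forall>a\<in>carrier R. \<forall>x\<in>carrier V. f (a \<odot>\<^bsub>V\<^esub> x) = a \<odot>\<^bsub>W\<^esub> f x)"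

definition left_ideal :: "'k set \<Rightarrow> ('k, 'd) ring_scheme \<Rightarrow> bool" where
  "left_ideal I K \<longleftrightarrow>
     additive_subgroup I K \<and> (\<forall>a\<in>carrier K. \<forall>x\<in>I. a \<otimes>\<^bsub>K\<^esub> x \<in> I)"

text \<open>The library's \<^locale>\<open>noetherian_ring\<close> is about two-sided ideals.\<close>

definition left_noetherian_ring :: "('k, 'd) ring_scheme \<Rightarrow> bool" where
  "left_noetherian_ring K \<longleftrightarrow>
     ring K \<and>
     (\<forall>I. left_ideal I K \<longrightarrow>
        (\<exists>A. A \<subseteq> carrier K \<and> finite A \<and> I = \<Inter>{J. left_ideal J K \<and> A \<subseteq> J}))"


section \<open>Categories and their representations\<close>

text \<open>\<open>Comp C x y z g f\<close> is the composite of \<open>f \<in> Hom C x y\<close> and \<open>g \<in> Hom C y z\<close>.\<close>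

record ('o, 'm) cat_data =
  Ob :: "'o set"
  Hom :: "'o \<Rightarrow> 'o \<Rightarrow> 'm set"
  Ident :: "'o \<Rightarrow> 'm"
  Comp :: "'o \<Rightarrow> 'o \<Rightarrow> 'o \<Rightarrow> 'm \<Rightarrow> 'm \<Rightarrow> 'm"

record ('o, 'm, 'k, 'v) rep_data =
  obj :: "'o \<Rightarrow> ('k, 'v) module"
  mor :: "'o \<Rightarrow> 'o \<Rightarrow> 'm \<Rightarrow> 'v \<Rightarrow> 'v"

text \<open>The condition that the composite lies in \<open>Hom C x z\<close> holds automatically if \<open>C\<close> is a
  category. It matters for the splittable maps below, which are closed under composition only if
  the finite commutative ring \<open>R\<close> is reduced: over the integers modulo 4, both
  \<open>x \<mapsto> (x, 0)\<close> and \<open>(x, y) \<mapsto> 2x + y\<close> are splittable, but their composite \<open>x \<mapsto> 2x\<close> is not.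
  A functor on the splittable maps respects every composition that stays among them.\<close>

definition representation ::
    "('k, 'd) ring_scheme \<Rightarrow> ('o, 'm) cat_data \<Rightarrow> ('o, 'm, 'k, 'v) rep_data \<Rightarrow> bool" where
  "representation K C M \<longleftrightarrow>
     (\<forall>x\<in>Ob C. left_module K (obj M x)) \<and>
     (\<forall>x\<in>Ob C. \<forall>y\<in>Ob C. \<forall>f\<in>Hom C x y. linear_map K (obj M x) (obj M y) (mor M x y f)) \<and>
     (\<forall>x\<in>Ob C. \<forall>v\<in>carrier (obj M x). mor M x x (Ident C x) v = v) \<and>
     (\<forall>x\<in>Ob C. \<forall>y\<in>Ob C. \<forall>z\<in>Ob C. \<forall>f\<in>Hom C x y. \<forall>g\<in>Hom C y z.
        Comp C x y z g f \<in> Hom C x z \<longrightarrow>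
        (\<forall>v\<in>carrier (obj M x). mor M x z (Comp C x y z g f) v = mor M y z g (mor M x y f v)))"

definition subrepresentation ::
    "('k, 'd) ring_scheme \<Rightarrow> ('o, 'm) cat_data \<Rightarrow> ('o, 'm, 'k, 'v) rep_data \<Rightarrow>
     ('o \<Rightarrow> 'v set) \<Rightarrow> bool" where
  "subrepresentation K C M N \<longleftrightarrow>
     (\<forall>x\<in>Ob C. submodule (N x) K (obj M x)) \<and>
     (\<forall>x\<in>Ob C. \<forall>y\<in>Ob C. \<forall>f\<in>Hom C x y. mor M x y f ` N x \<subseteq> N y)"

definition restrict_rep ::
    "('o, 'm, 'k, 'v) rep_data \<Rightarrow> ('o \<Rightarrow> 'v set) \<Rightarrow> ('o, 'm, 'k, 'v) rep_data" where
  "restrict_rep M N = M\<lparr>obj := \<lambda>x. (obj M x)\<lparr>carrier := N x\<rparr>\<rparr>"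

definition finitely_generated_rep ::
    "('k, 'd) ring_scheme \<Rightarrow> ('o, 'm) cat_data \<Rightarrow> ('o, 'm, 'k, 'v) rep_data \<Rightarrow> bool" where
  "finitely_generated_rep K C M \<longleftrightarrow>
     (\<exists>S \<subseteq> (SIGMA x:Ob C. carrier (obj M x)). finite S \<and>
        (\<forall>N. subrepresentation K C M N \<and> (\<forall>(x, v)\<in>S. v \<in> N x) \<longrightarrow>
           (\<forall>x\<in>Ob C. N x = carrier (obj M x))))"

text \<open>The type argument is the universe from which the elements of the modules \<open>M x\<close> are
  taken.\<close>

definition Rep_noetherian ::
    "'v itself \<Rightarrow> ('k, 'd) ring_scheme \<Rightarrow> ('o, 'm) cat_data \<Rightarrow> bool" where
  "Rep_noetherian _ K C \<longleftrightarrow>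
     (\<forall>(M :: ('o, 'm, 'k, 'v) rep_data) N.
        representation K C M \<and> finitely_generated_rep K C M \<and> subrepresentation K C M N \<longrightarrow>
        finitely_generated_rep K C (restrict_rep M N))"


section \<open>Free modules, splittable maps, and the categories VA and VI\<close>

definition basis :: "('r, 'd) ring_scheme \<Rightarrow> ('r, 'u) module \<Rightarrow> 'u set \<Rightarrow> bool" where
  "basis R V B \<longleftrightarrow>
     finite B \<and> B \<subseteq> carrier V \<and>
     (\<forall>v\<in>carrier V. \<exists>!c. c \<in> B \<rightarrow>\<^sub>E carrier R \<and> v = (\<Oplus>\<^bsub>V\<^esub>b\<in>B. c b \<odot>\<^bsub>V\<^esub> b))"

definition finite_rank_free :: "('r, 'd) ring_scheme \<Rightarrow> ('r, 'u) module \<Rightarrow> bool" where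
  "finite_rank_free R V \<longleftrightarrow> module R V \<and> (\<exists>B. basis R V B)"

definition direct_summand ::
    "('r, 'd) ring_scheme \<Rightarrow> ('r, 'u) module \<Rightarrow> 'u set \<Rightarrow> bool" where
  "direct_summand R W A \<longleftrightarrow>
     submodule A R W \<and>
     (\<exists>B. submodule B R W \<and> A \<inter> B = {\<zero>\<^bsub>W\<^esub>} \<and> A <+>\<^bsub>W\<^esub> B = carrier W)"

definition splittable ::
    "('r, 'd) ring_scheme \<Rightarrow> ('r, 'u) module \<Rightarrow> ('r, 'v) module \<Rightarrow> ('u \<Rightarrow> 'v) \<Rightarrow> bool" where
  "splittable R V W f \<longleftrightarrow> linear_map R V W f \<and> direct_summand R W (f ` carrier V)"

text \<open>The elements of the objects are taken from an infinite type \<open>'u\<close>. Since the finite-rank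
  free modules over a finite ring are finite, every one of them has an isomorphic copy in \<open>'u\<close>.
  Morphisms are extensional functions, so that they are determined by their values on the
  source.\<close>

definition VA :: "('r, 'd) ring_scheme \<Rightarrow> (('r, 'u::infinite) module, 'u \<Rightarrow> 'u) cat_data" where
  "VA R = \<lparr>Ob = {V. finite_rank_free R V},
           Hom = (\<lambda>V W. {f \<in> extensional (carrier V). splittable R V W f}),
           Ident = (\<lambda>V. \<lambda>x\<in>carrier V. x),
           Comp = (\<lambda>U V W g f. compose (carrier U) g f)\<rparr>"

definition VI :: "('r, 'd) ring_scheme \<Rightarrow> (('r, 'u::infinite) module, 'u \<Rightarrow> 'u) cat_data" where
  "VI R = (VA R)\<lparr>Hom := (\<lambda>V W. {f \<in> Hom (VA R) V W. inj_on f (carrier V)})\<rparr>"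

end

theory Submission
  imports Defs "HOL-Library.Sublist"
begin

text \<open>A linear map \<open>V \<rightarrow> R\<^sup>n\<close> is a word of length \<open>n\<close> in the finite alphabet of linear functionals
  on \<open>V\<close>, so a finitely generated representation of VI is spanned on \<open>R\<^sup>n\<close> by elements labelled by
  words. An ordered surjection \<open>f\<close> from \<open>m\<close> to \<open>n\<close> induces a split injection \<open>R\<^sup>n \<rightarrow> R\<^sup>m\<close>, which
  replaces a word \<open>w\<close> by \<open>w \<circ> f\<close> and preserves the lexicographic order. By Higman's lemma the
  words are well-quasi-ordered under \<open>w \<le> w \<circ> f\<close>. If a subrepresentation were not finitely
  generated, choosing successive new elements with minimal leading word would give an infinite
  chain of leading words, and since the leading coefficients lie in a left-noetherian ring, one
  of them could be cancelled using earlier elements, contradicting minimality.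

  A representation of VA extends uniquely to all linear maps between free modules, composable or
  not within VA, by factoring a map through its graph. Hence a finitely generated representation
  of VA is spanned by the images of its generators under all linear maps, and the same argument
  applies to it.\<close>

section \<open>Ordered surjections and words\<close>

text \<open>The elements labelled by words may be linearly dependent, so a vector has no
  well-defined leading word. What replaces it is a minimal label for which the span of the elements
  up to that label contains a new vector; leading coefficients are taken modulo the span of the
  strictly smaller labels.

  The comparison of words uses only maps that repeat coordinates, and these are split by a section
  of the surjection. Hence the whole argument runs over VI, and a representation of VA is restricted
  to VI for it.

  What VA needs in addition is a spanning set stable under morphisms. When a composite of splittable
  maps is not splittable, functoriality does not express the image of an image as an image under one
  morphism; with all linear maps allowed, this obstacle disappears.\<close>

text \<open>A whole increasing subsequence is asked for, and not just one increasing pair, because a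
  coefficient will be compared with those of all earlier members of the chain at once.\<close>

definition has_chains :: "('a \<Rightarrow> 'a \<Rightarrow> bool) \<Rightarrow> 'a set \<Rightarrow> bool" where
  "has_chains P S \<longleftrightarrow>
     (\<forall>s :: nat \<Rightarrow> 'a. (\<forall>n. s n \<in> S) \<longrightarrow>
        (\<exists>r :: nat \<Rightarrow> nat. strict_mono r \<and> (\<forall>i j. i < j \<longrightarrow> P (s (r i)) (s (r j)))))"

lemma has_chainsD:
  assumes "has_chains P S" "\<And>n :: nat. s n \<in> S"
  shows "\<exists>r :: nat \<Rightarrow> nat. strict_mono r \<and> (\<forall>i j. i < j \<longrightarrow> P (s (r i)) (s (r j)))"
  using assms unfolding has_chains_def by blast

lemma subsequence_constant:
  fixes s :: "nat \<Rightarrow> 'a"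
  assumes "finite S" "\<And>n. s n \<in> S"
  shows "\<exists>(r :: nat \<Rightarrow> nat) x. strict_mono r \<and> (\<forall>n. s (r n) = x)"
proof -
  have "finite (range s)"
    using assms by (meson finite_subset image_subsetI)
  then obtain x where "infinite (s -` {x})"
    using pigeonhole_infinite[of UNIV s] by (auto simp: vimage_def)
  with infinite_enumerate[of "s -` {x}"] show ?thesis
    by blast
qed

section \<open>Higman's lemma over a finite alphabet\<close>

text \<open>A word containing \<open>a\<close> is cut at its first \<open>a\<close> into
  \<open>x @ a # y\<close>: then \<open>x\<close> is a word over \<open>A - {a}\<close>, and
  \<open>y\<close> avoids \<open>v\<close> because the word avoids \<open>a # v\<close>. Successive
  subsequences make both parts increase, and the parts are joined around the common
  \<open>a\<close>. Words without \<open>a\<close> fall under the first hypothesis.\<close>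

lemma has_chains_avoiding:
  assumes "has_chains subseq {w. set w \<subseteq> A - {a}}"
    and "has_chains subseq {w. set w \<subseteq> A \<and> \<not> subseq v w}"
  shows "has_chains subseq {w. set w \<subseteq> A \<and> \<not> subseq (a # v) w}"
  unfolding has_chains_def
proof (intro allI impI)
  fix s :: "nat \<Rightarrow> 'a list"
  assume s: "\<forall>n. s n \<in> {w. set w \<subseteq> A \<and> \<not> subseq (a # v) w}"
  show "\<exists>r :: nat \<Rightarrow> nat. strict_mono r \<and> (\<forall>i j. i < j \<longrightarrow> subseq (s (r i)) (s (r j)))"
  proof (cases "finite {n. a \<in> set (s n)}")
    case True
    then have "infinite {n. a \<notin> set (s n)}"
      by (simp add: finite_Collect_not)
    then obtain r0 :: "nat \<Rightarrow> nat" where r0: "strict_mono r0" "\<And>n. a \<notin> set (s (r0 n))"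
      using infinite_enumerate by blast
    have "s (r0 n) \<in> {w. set w \<subseteq> A - {a}}" for n
      using s r0(2)[of n] by auto
    from has_chainsD[OF assms(1), of "\<lambda>n. s (r0 n)", OF this] obtain r :: "nat \<Rightarrow> nat" where
      r: "strict_mono r" "\<forall>i j. i < j \<longrightarrow> subseq (s (r0 (r i))) (s (r0 (r j)))"
      by blast
    then show ?thesis
      using r0(1) by (intro exI[of _ "r0 \<circ> r"]) (auto intro: strict_mono_o)
  next
    case False
    then obtain r0 :: "nat \<Rightarrow> nat" where r0: "strict_mono r0" "\<And>n. a \<in> set (s (r0 n))"
      using infinite_enumerate by blast
    have "\<forall>n. \<exists>x y. s (r0 n) = x @ a # y \<and> a \<notin> set x"
      using split_list_first[OF r0(2)] by blast
    then obtain x y where xy: "\<And>n :: nat. s (r0 n) = x n @ a # y n" "\<And>n. a \<notin> set (x n)"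
      by metis
    have sA: "set (s (r0 n)) \<subseteq> A" "\<not> subseq (a # v) (s (r0 n))" for n
      using s by auto
    have x: "x n \<in> {w. set w \<subseteq> A - {a}}" for n
      using sA(1)[of n] xy(2)[of n] unfolding xy(1) by auto
    have y: "y n \<in> {w. set w \<subseteq> A \<and> \<not> subseq v w}" for n
      using sA[of n] unfolding xy(1) by (auto intro: subseq_drop_many)
    from has_chainsD[OF assms(1), of x, OF x] obtain r1 :: "nat \<Rightarrow> nat" where
      r1: "strict_mono r1" "\<forall>i j. i < j \<longrightarrow> subseq (x (r1 i)) (x (r1 j))"
      by blast
    from has_chainsD[OF assms(2), of "\<lambda>n. y (r1 n)", OF y] obtain r2 :: "nat \<Rightarrow> nat" where
      r2: "strict_mono r2" "\<forall>i j. i < j \<longrightarrow> subseq (y (r1 (r2 i))) (y (r1 (r2 j)))"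
      by blast
    have "subseq (s (r0 (r1 (r2 i)))) (s (r0 (r1 (r2 j))))" if "i < j" for i j
      unfolding xy(1) using r1(2) r2 that
      by (intro list_emb_append_mono subseq_Cons2) (auto dest: strict_monoD)
    then show ?thesis
      using r0(1) r1(1) r2(1)
      by (intro exI[of _ "r0 \<circ> r1 \<circ> r2"]) (auto intro: strict_mono_o)
  qed
qed

text \<open>The outer induction is on the alphabet, the inner one on the forbidden word
  \<open>v\<close>. If some \<open>s k\<close> fails to embed in infinitely many terms, those terms
  avoid \<open>s k\<close> and \<open>avoid\<close> applies; otherwise each term embeds in a later
  one, and iteration gives a chain by transitivity.\<close>

theorem Higman_finite:
  assumes "finite A"
  shows "has_chains subseq {w. set w \<subseteq> A}"
  using assms
proof (induction A rule: finite_psubset_induct)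
  case (psubset A)
  have avoid: "has_chains subseq {w. set w \<subseteq> A \<and> \<not> subseq v w}" if "set v \<subseteq> A" for v
    using that
  proof (induction v)
    case Nil
    then show ?case by (simp add: has_chains_def)
  next
    case (Cons a v)
    then show ?case
      using psubset.IH[of "A - {a}"] by (intro has_chains_avoiding) auto
  qed
  show ?case
    unfolding has_chains_def
  proof (intro allI impI)
    fix s :: "nat \<Rightarrow> 'a list"
    assume s: "\<forall>n. s n \<in> {w. set w \<subseteq> A}"
    show "\<exists>r :: nat \<Rightarrow> nat. strict_mono r \<and> (\<forall>i j. i < j \<longrightarrow> subseq (s (r i)) (s (r j)))"
    proof (cases "\<exists>k. infinite {n. \<not> subseq (s k) (s n)}")
      case True
      then obtain k where "infinite {n. \<not> subseq (s k) (s n)}" by blast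
      then obtain r0 :: "nat \<Rightarrow> nat" where r0: "strict_mono r0" "\<And>n. \<not> subseq (s k) (s (r0 n))"
        using infinite_enumerate by blast
      have "set (s k) \<subseteq> A" "s (r0 n) \<in> {w. set w \<subseteq> A \<and> \<not> subseq (s k) w}" for n
        using s r0(2) by auto
      from has_chainsD[OF avoid[OF this(1)], of "\<lambda>n. s (r0 n)", OF this(2)] obtain r :: "nat \<Rightarrow> nat" where
        r: "strict_mono r" "\<forall>i j. i < j \<longrightarrow> subseq (s (r0 (r i))) (s (r0 (r j)))"
        by blast
      then show ?thesis
        using r0(1) by (intro exI[of _ "r0 \<circ> r"]) (auto intro: strict_mono_o)
    next
      case False
      have "\<exists>n>k. subseq (s k) (s n)" for k
      proof -
        have "finite ({n. \<not> subseq (s k) (s n)} \<union> {..k})"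
          using False by simp
        then obtain n where "n \<notin> {n. \<not> subseq (s k) (s n)} \<union> {..k}"
          using ex_new_if_finite infinite_UNIV_nat by blast
        then show ?thesis by (intro exI[of _ n]) auto
      qed
      then obtain g where g: "\<And>k. k < g k" "\<And>k. subseq (s k) (s (g k))"
        by metis
      define r where "r i = (g ^^ i) 0" for i
      have "strict_mono r"
        by (simp add: strict_mono_Suc_iff r_def g)
      moreover have "subseq (s (r i)) (s (r j))" if "i < j" for i j
        using that
      proof (induction j)
        case (Suc j)
        moreover have "subseq (s (r j)) (s (r (Suc j)))"
          by (simp add: r_def g)
        ultimately show ?case
          by (metis less_Suc_eq subseq_order.trans)
      qed simp
      ultimately show ?thesis by blast
    qed
  qed
qed

text \<open>The condition on \<open>f\<close> says that the values of \<open>f\<close> first occur in increasing order.\<close>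

definition ordered_surj :: "nat \<Rightarrow> nat \<Rightarrow> (nat \<Rightarrow> nat) \<Rightarrow> bool" where
  "ordered_surj m n f \<longleftrightarrow>
     (\<forall>j<m. f j < n \<and> (\<forall>k<f j. \<exists>i<j. f i = k)) \<and> (\<forall>k<n. \<exists>j<m. f j = k)"

definition pull_word :: "nat \<Rightarrow> (nat \<Rightarrow> nat) \<Rightarrow> 'a list \<Rightarrow> 'a list" where
  "pull_word m f w = map (\<lambda>j. w ! f j) [0..<m]"

lemma length_pull_word [simp]: "length (pull_word m f w) = m"
  by (simp add: pull_word_def)

lemma nth_pull_word [simp]: "j < m \<Longrightarrow> pull_word m f w ! j = w ! f j"
  by (simp add: pull_word_def)

lemma set_pull_word:
  assumes "ordered_surj m (length w) f"
  shows "set (pull_word m f w) \<subseteq> set w"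
  using assms by (auto simp: pull_word_def ordered_surj_def)

text \<open>Since \<open>f\<close> is an ordered surjection, both words have the same letters with
  the same order of first occurrences. This invariant has to be fixed before an embedding of words
  can yield the relation.\<close>

definition word_le :: "'a list \<Rightarrow> 'a list \<Rightarrow> bool" where
  "word_le w u \<longleftrightarrow> (\<exists>f. ordered_surj (length u) (length w) f \<and> u = pull_word (length u) f w)"

lemma word_le_Nil: "word_le [] []"
  by (simp add: word_le_def ordered_surj_def pull_word_def)

text \<open>The added position of \<open>u\<close> is sent to the added position of
  \<open>w\<close>. A new value may occur there because, by surjectivity of \<open>f\<close>, all
  smaller values have occurred before.\<close>

lemma word_le_snoc:
  assumes "word_le w u"
  shows "word_le (w @ [a]) (u @ [a])"
proof -
  obtain f where f: "ordered_surj (length u) (length w) f" "u = pull_word (length u) f w"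
    using assms by (auto simp: word_le_def)
  define g where "g = f(length u := length w)"
  have u: "u ! j = w ! f j" if "j < length u" for j
    by (subst f(2)) (simp add: that)
  have "ordered_surj (length (u @ [a])) (length (w @ [a])) g"
    using f(1) unfolding ordered_surj_def g_def
    by (auto simp: less_Suc_eq) (metis less_irrefl_nat less_trans)+
  moreover have "u @ [a] = pull_word (length (u @ [a])) g (w @ [a])"
    using f(1) u unfolding ordered_surj_def g_def
    by (intro nth_equalityI) (auto simp: nth_append)
  ultimately show ?thesis
    unfolding word_le_def by blast
qed

text \<open>The added letter is sent to an old position of \<open>w\<close> with the same letter, so
  no new first occurrence arises.\<close>

lemma word_le_repeat:
  assumes "word_le w u" "a \<in> set w"
  shows "word_le w (u @ [a])"
proof -
  obtain f where f: "ordered_surj (length u) (length w) f" "u = pull_word (length u) f w"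
    using assms by (auto simp: word_le_def)
  obtain i where i: "i < length w" "w ! i = a"
    using assms(2) by (auto simp: in_set_conv_nth)
  define g where "g = f(length u := i)"
  have u: "u ! j = w ! f j" if "j < length u" for j
    by (subst f(2)) (simp add: that)
  have "ordered_surj (length (u @ [a])) (length w) g"
    using f(1) i unfolding ordered_surj_def g_def
    by (auto simp: less_Suc_eq) (metis less_irrefl_nat less_trans)+
  moreover have "u @ [a] = pull_word (length (u @ [a])) g w"
    using f(1) u i unfolding ordered_surj_def g_def
    by (intro nth_equalityI) (auto simp: nth_append)
  ultimately show ?thesis
    unfolding word_le_def by blast
qed

text \<open>Each letter is marked with whether it occurs again further to the right; the words are read
  from right to left below, so the unmarked letters are the first occurrences.\<close>

fun mark :: "'a list \<Rightarrow> ('a \<times> bool) list" where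
  "mark [] = []"
| "mark (a # w) = (a, a \<in> set w) # mark w"

lemma fst_set_mark: "fst ` set (mark w) = set w"
  by (induction w) auto

lemma in_set_mark_new: "a \<in> set w \<Longrightarrow> (a, False) \<in> set (mark w)"
  by (induction w) auto

lemma set_subseq: "subseq xs ys \<Longrightarrow> set xs \<subseteq> set ys"
  by (auto elim: list_emb_set)

text \<open>Induction on the head of \<open>u\<close>. If the embedding matches it, equality of the
  marks means that \<open>remdups\<close> drops it on both sides or on neither, so the tails again
  agree. If it is skipped, it still occurs in \<open>w\<close>, hence by the embedding in the rest
  of \<open>u\<close>, and is a repetition.\<close>

lemma subseq_mark_imp_word_le:
  "subseq (mark w) (mark u) \<Longrightarrow> remdups w = remdups u \<Longrightarrow> word_le (rev w) (rev u)"
proof (induction u arbitrary: w)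
  case Nil
  then show ?case by (simp add: word_le_Nil)
next
  case (Cons a u)
  consider (keep) w' where "w = a # w'" "a \<in> set w' \<longleftrightarrow> a \<in> set u" "subseq (mark w') (mark u)"
    | (skip) "subseq (mark w) (mark u)"
  proof (cases w)
    case Nil
    then show ?thesis using that(2) by simp
  next
    case (Cons b w')
    then show ?thesis
      using Cons.prems(1) that by (auto simp: subseq_Cons2_iff split: if_splits)
  qed
  then show ?case
  proof cases
    case keep
    then have "remdups w' = remdups u"
      using Cons.prems(2) by (auto split: if_splits)
    with keep Cons.IH[of w'] show ?thesis
      by (simp add: word_le_snoc)
  next
    case skip
    have "a \<in> set w"
      using Cons.prems(2) by (metis list.set_intros(1) set_remdups)
    then have "a \<in> set u"
      using set_subseq[OF skip] in_set_mark_new fst_set_mark by force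
    then have "word_le (rev w) (rev u)"
      using Cons skip by simp
    with \<open>a \<in> set w\<close> show ?thesis
      by (simp add: word_le_repeat)
  qed
qed

text \<open>On reversed words \<open>remdups\<close> lists the first occurrences. Only finitely many
  such lists exist, so the list is made constant on a subsequence before Higman's lemma is applied
  to the marked letters.\<close>

theorem word_le_chains:
  assumes "finite A"
  shows "has_chains word_le {w. set w \<subseteq> A}"
  unfolding has_chains_def
proof (intro allI impI)
  fix s :: "nat \<Rightarrow> 'a list"
  assume s: "\<forall>n. s n \<in> {w. set w \<subseteq> A}"
  have "finite {w. set w \<subseteq> A \<and> distinct w}"
    by (rule finite_subset_distinct[OF assms])
  moreover have "remdups (rev (s n)) \<in> {w. set w \<subseteq> A \<and> distinct w}" for n
    using s by auto
  ultimately obtain r0 :: "nat \<Rightarrow> nat" and x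
    where r0: "strict_mono r0" "\<forall>n. remdups (rev (s (r0 n))) = x"
    using subsequence_constant[where s = "\<lambda>n. remdups (rev (s n))"] by blast
  have "mark (rev (s (r0 n))) \<in> {w. set w \<subseteq> A \<times> UNIV}" for n
    using s fst_set_mark[of "rev (s (r0 n))"] by (force simp: mem_Times_iff)
  moreover have "finite (A \<times> (UNIV :: bool set))"
    using assms by simp
  ultimately obtain r :: "nat \<Rightarrow> nat" where r: "strict_mono r"
    "\<forall>i j. i < j \<longrightarrow> subseq (mark (rev (s (r0 (r i))))) (mark (rev (s (r0 (r j)))))"
    using has_chainsD[OF Higman_finite, where s = "\<lambda>n. mark (rev (s (r0 n)))"] by blast
  have "word_le (s (r0 (r i))) (s (r0 (r j)))" if "i < j" for i j
    using r(2) r0(2) that by (intro subseq_mark_imp_word_le[of "rev (s _)" "rev (s _)", simplified]) simp_all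
  then show "\<exists>r :: nat \<Rightarrow> nat. strict_mono r \<and> (\<forall>i j. i < j \<longrightarrow> word_le (s (r i)) (s (r j)))"
    using r0(1) r(1) by (intro exI[of _ "r0 \<circ> r"]) (auto intro: strict_mono_o)
qed

section \<open>The lexicographic order and pull-backs of words\<close>

lemma lex_nth_conv:
  assumes "length w = length u"
  shows "(w, u) \<in> lex less_than \<longleftrightarrow>
    (\<exists>p<length w. w ! p < (u ! p :: nat) \<and> (\<forall>q<p. w ! q = u ! q))"
proof
  assume "(w, u) \<in> lex less_than"
  then show "\<exists>p<length w. w ! p < u ! p \<and> (\<forall>q<p. w ! q = u ! q)"
    by (force simp: lex_conv nth_append)
next
  assume "\<exists>p<length w. w ! p < u ! p \<and> (\<forall>q<p. w ! q = u ! q)"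
  then obtain p where p: "p < length w" "w ! p < u ! p" "\<forall>q<p. w ! q = u ! q" by blast
  have "take p w = take p u"
    using p assms by (intro nth_equalityI) auto
  then have "w = take p w @ w ! p # drop (Suc p) w" "u = take p w @ u ! p # drop (Suc p) u"
    using p assms id_take_nth_drop[of p w] id_take_nth_drop[of p u] by simp_all
  with p(2) assms show "(w, u) \<in> lex less_than"
    unfolding lex_conv by blast
qed

text \<open>At the first occurrence of the first position where \<open>w\<close> and \<open>u\<close> differ, none of the later
  positions has occurred yet.\<close>

lemma lex_pull_word:
  assumes "ordered_surj m n f" "length w = n" "length u = n" "(w, u) \<in> lex less_than"
  shows "(pull_word m f w, pull_word m f u) \<in> lex less_than"
proof -
  obtain p where p: "p < n" "w ! p < u ! p" "\<forall>q<p. w ! q = u ! q"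
    using assms by (auto simp: lex_nth_conv)
  define j where "j = (LEAST j. f j = p)"
  obtain j0 where j0: "j0 < m" "f j0 = p"
    using assms(1) p(1) by (auto simp: ordered_surj_def)
  have j: "f j = p" "j < m"
    unfolding j_def using j0 LeastI[of "\<lambda>j. f j = p" j0] Least_le[of "\<lambda>j. f j = p" j0]
    by auto
  have "f i < p" if "i < j" for i
  proof (rule ccontr)
    assume "\<not> f i < p"
    moreover have ne: "f i' \<noteq> p" if "i' < j" for i'
      using that not_less_Least unfolding j_def by blast
    ultimately have "p < f i"
      using that by force
    moreover have "i < m"
      using that j(2) by simp
    ultimately obtain i' where "i' < i" "f i' = p"
      using assms(1) unfolding ordered_surj_def by blast
    with ne[of i'] that show False
      by simp
  qed
  then have "w ! f q = u ! f q" if "q < j" for q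
    using p(3) that by simp
  moreover have "w ! f j < u ! f j"
    using p(2) j(1) by simp
  ultimately have "\<exists>i<m. w ! f i < u ! f i \<and> (\<forall>q<i. w ! f q = u ! f q)"
    using j(2) by blast
  then show ?thesis
    by (auto simp: lex_nth_conv)
qed

section \<open>Left modules\<close>

lemma submodule_simps:
  assumes "submodule H K M"
  shows "H \<subseteq> carrier M" "\<zero>\<^bsub>M\<^esub> \<in> H"
    "\<And>x y. x \<in> H \<Longrightarrow> y \<in> H \<Longrightarrow> x \<oplus>\<^bsub>M\<^esub> y \<in> H"
    "\<And>x. x \<in> H \<Longrightarrow> \<ominus>\<^bsub>M\<^esub> x \<in> H"
    "\<And>a x. a \<in> carrier K \<Longrightarrow> x \<in> H \<Longrightarrow> a \<odot>\<^bsub>M\<^esub> x \<in> H"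
proof -
  have "subgroup H (add_monoid M)"
    using assms by (rule submodule.axioms)
  then show "H \<subseteq> carrier M" "\<zero>\<^bsub>M\<^esub> \<in> H"
    "\<And>x y. x \<in> H \<Longrightarrow> y \<in> H \<Longrightarrow> x \<oplus>\<^bsub>M\<^esub> y \<in> H"
    "\<And>x. x \<in> H \<Longrightarrow> \<ominus>\<^bsub>M\<^esub> x \<in> H"
    using subgroup.subset subgroup.one_closed subgroup.m_closed subgroup.m_inv_closed
    by (fastforce simp: a_inv_def)+
  show "\<And>a x. a \<in> carrier K \<Longrightarrow> x \<in> H \<Longrightarrow> a \<odot>\<^bsub>M\<^esub> x \<in> H"
    using assms by (rule submodule.smult_closed)
qed

context left_module
begin

lemma smult_l_null [simp]:
  assumes "x \<in> carrier M"
  shows "\<zero> \<odot>\<^bsub>M\<^esub> x = \<zero>\<^bsub>M\<^esub>"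
proof -
  have "\<zero> \<odot>\<^bsub>M\<^esub> x \<oplus>\<^bsub>M\<^esub> \<zero> \<odot>\<^bsub>M\<^esub> x = \<zero> \<odot>\<^bsub>M\<^esub> x"
    using smult_l_distr[of \<zero> \<zero> x] assms by simp
  then show ?thesis
    using assms by (metis M.add.r_cancel_one' R.zero_closed smult_closed)
qed

lemma smult_r_null [simp]:
  assumes "a \<in> carrier R"
  shows "a \<odot>\<^bsub>M\<^esub> \<zero>\<^bsub>M\<^esub> = \<zero>\<^bsub>M\<^esub>"
proof -
  have "a \<odot>\<^bsub>M\<^esub> \<zero>\<^bsub>M\<^esub> \<oplus>\<^bsub>M\<^esub> a \<odot>\<^bsub>M\<^esub> \<zero>\<^bsub>M\<^esub> = a \<odot>\<^bsub>M\<^esub> \<zero>\<^bsub>M\<^esub>"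
    using smult_r_distr[of a "\<zero>\<^bsub>M\<^esub>" "\<zero>\<^bsub>M\<^esub>"] assms by simp
  then show ?thesis
    using assms by (metis M.add.r_cancel_one' M.zero_closed smult_closed)
qed

lemma smult_l_minus:
  assumes "a \<in> carrier R" "x \<in> carrier M"
  shows "(\<ominus> a) \<odot>\<^bsub>M\<^esub> x = \<ominus>\<^bsub>M\<^esub> (a \<odot>\<^bsub>M\<^esub> x)"
proof -
  have "(\<ominus> a) \<odot>\<^bsub>M\<^esub> x \<oplus>\<^bsub>M\<^esub> a \<odot>\<^bsub>M\<^esub> x = \<zero>\<^bsub>M\<^esub>"
    using smult_l_distr[of "\<ominus> a" a x] assms by (simp add: R.l_neg)
  then show ?thesis
    using assms M.minus_equality by force
qed

lemma left_submoduleI: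
  assumes "H \<subseteq> carrier M" "\<zero>\<^bsub>M\<^esub> \<in> H"
    and "\<And>x y. x \<in> H \<Longrightarrow> y \<in> H \<Longrightarrow> x \<oplus>\<^bsub>M\<^esub> y \<in> H"
    and "\<And>a x. a \<in> carrier R \<Longrightarrow> x \<in> H \<Longrightarrow> a \<odot>\<^bsub>M\<^esub> x \<in> H"
  shows "submodule H R M"
proof -
  have "\<ominus>\<^bsub>M\<^esub> x \<in> H" if "x \<in> H" for x
    using assms(1) assms(4)[of "\<ominus> \<one>" x] smult_l_minus[of \<one> x] that by auto
  with assms show ?thesis
    by (intro submodule.intro subgroup.intro) (auto simp: submodule_axioms_def a_inv_def)
qed

text \<open>With \<open>m\<close> the element of a label and \<open>F\<close> the span of the
  smaller labels, this is the ideal of leading coefficients of \<open>N\<close>. As \<open>m\<close>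
  may depend on \<open>F\<close>, such a coefficient belongs to an expression and not to a
  vector.\<close>

lemma left_ideal_leading_coefficients:
  assumes N: "submodule N R M" and F: "submodule F R M" and m: "m \<in> carrier M"
  shows "left_ideal {d \<in> carrier R. \<exists>z\<in>F. d \<odot>\<^bsub>M\<^esub> m \<oplus>\<^bsub>M\<^esub> z \<in> N} R"
    (is "left_ideal ?J R")
proof -
  note simps = submodule_simps[OF N] submodule_simps[OF F]
  have zF: "z \<in> carrier M" if "z \<in> F" for z
    using that simps by auto
  have "\<zero> \<in> ?J"
    using m simps by (auto intro!: bexI[of _ "\<zero>\<^bsub>M\<^esub>"])
  moreover have "a \<oplus> b \<in> ?J" if ab: "a \<in> ?J" "b \<in> ?J" for a b
  proof -
    obtain y z where yz: "y \<in> F" "a \<odot>\<^bsub>M\<^esub> m \<oplus>\<^bsub>M\<^esub> y \<in> N" "z \<in> F" "b \<odot>\<^bsub>M\<^esub> m \<oplus>\<^bsub>M\<^esub> z \<in> N"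
      using ab by blast
    have "(a \<oplus> b) \<odot>\<^bsub>M\<^esub> m \<oplus>\<^bsub>M\<^esub> (y \<oplus>\<^bsub>M\<^esub> z)
        = (a \<odot>\<^bsub>M\<^esub> m \<oplus>\<^bsub>M\<^esub> y) \<oplus>\<^bsub>M\<^esub> (b \<odot>\<^bsub>M\<^esub> m \<oplus>\<^bsub>M\<^esub> z)"
      using ab m zF yz by (simp add: smult_l_distr M.a_ac)
    with ab yz simps show ?thesis
      by (auto intro!: bexI[of _ "y \<oplus>\<^bsub>M\<^esub> z"])
  qed
  moreover have mult: "a \<otimes> b \<in> ?J" if a: "a \<in> carrier R" and b: "b \<in> ?J" for a b
  proof -
    obtain z where z: "z \<in> F" "b \<odot>\<^bsub>M\<^esub> m \<oplus>\<^bsub>M\<^esub> z \<in> N"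
      using b by blast
    have "(a \<otimes> b) \<odot>\<^bsub>M\<^esub> m \<oplus>\<^bsub>M\<^esub> a \<odot>\<^bsub>M\<^esub> z = a \<odot>\<^bsub>M\<^esub> (b \<odot>\<^bsub>M\<^esub> m \<oplus>\<^bsub>M\<^esub> z)"
      using a b m zF z by (simp add: smult_r_distr smult_assoc1)
    with a b z simps show ?thesis
      by (auto intro!: bexI[of _ "a \<odot>\<^bsub>M\<^esub> z"])
  qed
  moreover have "\<ominus> a \<in> ?J" if "a \<in> ?J" for a
    using mult[of "\<ominus> \<one>" a] that by (auto simp: R.l_minus)
  ultimately have "subgroup ?J (add_monoid R)"
    by (intro subgroup.intro) (auto simp: a_inv_def)
  with mult show ?thesis
    by (auto simp: left_ideal_def additive_subgroup_def)
qed

end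

section \<open>Linear spans\<close>

text \<open>One scaled vector is added at a time, so that statements about linear combinations are
  proved by rule induction, without finite sums of coefficient families.\<close>

inductive_set lspan ::
    "('k, 'd) ring_scheme \<Rightarrow> ('k, 'v, 'e) module_scheme \<Rightarrow> 'v set \<Rightarrow> 'v set"
  for K M S where
  zero: "\<zero>\<^bsub>M\<^esub> \<in> lspan K M S"
| step: "a \<in> carrier K \<Longrightarrow> s \<in> S \<Longrightarrow> x \<in> lspan K M S \<Longrightarrow>
         a \<odot>\<^bsub>M\<^esub> s \<oplus>\<^bsub>M\<^esub> x \<in> lspan K M S"

lemma lspan_mono:
  assumes "S \<subseteq> T"
  shows "lspan K M S \<subseteq> lspan K M T"
proof
  fix x assume "x \<in> lspan K M S"
  then show "x \<in> lspan K M T"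
    using assms by induction (auto intro: lspan.intros)
qed

context left_module
begin

lemma lspan_closed:
  assumes "S \<subseteq> carrier M"
  shows "lspan R M S \<subseteq> carrier M"
proof
  fix x assume "x \<in> lspan R M S"
  then show "x \<in> carrier M"
    using assms by induction auto
qed

lemma lspan_add:
  assumes S: "S \<subseteq> carrier M" and "x \<in> lspan R M S" "y \<in> lspan R M S"
  shows "x \<oplus>\<^bsub>M\<^esub> y \<in> lspan R M S"
  using assms(2)
proof induction
  case zero
  then show ?case
    using lspan_closed[OF S] assms(3) by auto
next
  case (step a s x)
  then have "(a \<odot>\<^bsub>M\<^esub> s \<oplus>\<^bsub>M\<^esub> x) \<oplus>\<^bsub>M\<^esub> y = a \<odot>\<^bsub>M\<^esub> s \<oplus>\<^bsub>M\<^esub> (x \<oplus>\<^bsub>M\<^esub> y)"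
    using lspan_closed[OF S] S assms(3) by (intro M.a_assoc) auto
  then show ?case
    using step by (simp add: lspan.step)
qed

lemma lspan_smult:
  assumes S: "S \<subseteq> carrier M" and "x \<in> lspan R M S" and b: "b \<in> carrier R"
  shows "b \<odot>\<^bsub>M\<^esub> x \<in> lspan R M S"
  using assms(2)
proof induction
  case zero
  then show ?case
    using b by (simp add: lspan.zero)
next
  case (step a s x)
  moreover from step have "s \<in> carrier M" "x \<in> carrier M"
    using lspan_closed[OF S] S by auto
  ultimately have "b \<odot>\<^bsub>M\<^esub> (a \<odot>\<^bsub>M\<^esub> s \<oplus>\<^bsub>M\<^esub> x) = (b \<otimes> a) \<odot>\<^bsub>M\<^esub> s \<oplus>\<^bsub>M\<^esub> b \<odot>\<^bsub>M\<^esub> x"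
    using b by (simp add: smult_r_distr smult_assoc1)
  then show ?case
    using step b by (simp add: lspan.step)
qed

lemma submodule_lspan:
  assumes "S \<subseteq> carrier M"
  shows "submodule (lspan R M S) R M"
  using assms lspan_closed lspan_add lspan_smult lspan.zero
  by (intro left_submoduleI) auto

lemma lspan_superset:
  assumes "S \<subseteq> carrier M"
  shows "S \<subseteq> lspan R M S"
proof
  fix s assume "s \<in> S"
  then have "\<one> \<odot>\<^bsub>M\<^esub> s \<oplus>\<^bsub>M\<^esub> \<zero>\<^bsub>M\<^esub> \<in> lspan R M S"
    by (intro lspan.intros) auto
  then show "s \<in> lspan R M S"
    using assms \<open>s \<in> S\<close> by auto
qed

text \<open>Splitting off the coefficient of one chosen generator is how leading coefficients are
  read off later.\<close>

lemma lspan_insert: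
  assumes S: "insert t S \<subseteq> carrier M" and "x \<in> lspan R M (insert t S)"
  shows "\<exists>a\<in>carrier R. \<exists>z\<in>lspan R M S. x = a \<odot>\<^bsub>M\<^esub> t \<oplus>\<^bsub>M\<^esub> z"
  using assms(2)
proof induction
  case zero
  then show ?case
    using S by (intro bexI[of _ \<zero>] bexI[of _ "\<zero>\<^bsub>M\<^esub>"]) (auto intro: lspan.zero)
next
  case (step b s x)
  then obtain a z where az: "a \<in> carrier R" "z \<in> lspan R M S" "x = a \<odot>\<^bsub>M\<^esub> t \<oplus>\<^bsub>M\<^esub> z"
    by blast
  have S': "S \<subseteq> carrier M" and t: "t \<in> carrier M" and s: "s \<in> carrier M"
    using S step by auto
  then have z: "z \<in> carrier M"
    using az(2) lspan_closed by blast
  consider "s = t" | "s \<in> S"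
    using step by blast
  then show ?case
  proof cases
    case 1
    have "b \<odot>\<^bsub>M\<^esub> s \<oplus>\<^bsub>M\<^esub> x = (b \<oplus> a) \<odot>\<^bsub>M\<^esub> t \<oplus>\<^bsub>M\<^esub> z"
      using 1 az(1,3) step(1) t z by (simp add: smult_l_distr M.a_assoc)
    with az step(1) show ?thesis
      by blast
  next
    case 2
    have "b \<odot>\<^bsub>M\<^esub> s \<oplus>\<^bsub>M\<^esub> x = a \<odot>\<^bsub>M\<^esub> t \<oplus>\<^bsub>M\<^esub> (b \<odot>\<^bsub>M\<^esub> s \<oplus>\<^bsub>M\<^esub> z)"
      using az(1,3) step(1) t z s by (simp add: M.a_lcomm)
    with az step(1) 2 show ?thesis
      by (blast intro: lspan.step)
  qed
qed

end

lemma linear_mapD: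
  assumes "linear_map K V W f"
  shows "\<And>x. x \<in> carrier V \<Longrightarrow> f x \<in> carrier W"
    "\<And>x y. x \<in> carrier V \<Longrightarrow> y \<in> carrier V \<Longrightarrow> f (x \<oplus>\<^bsub>V\<^esub> y) = f x \<oplus>\<^bsub>W\<^esub> f y"
    "\<And>a x. a \<in> carrier K \<Longrightarrow> x \<in> carrier V \<Longrightarrow> f (a \<odot>\<^bsub>V\<^esub> x) = a \<odot>\<^bsub>W\<^esub> f x"
  using assms by (auto simp: linear_map_def)

lemma linear_map_zero:
  assumes "linear_map K V W f" "abelian_group V" "abelian_group W"
  shows "f \<zero>\<^bsub>V\<^esub> = \<zero>\<^bsub>W\<^esub>"
proof -
  interpret V: abelian_group V by fact
  interpret W: abelian_group W by fact
  have "f \<zero>\<^bsub>V\<^esub> \<oplus>\<^bsub>W\<^esub> f \<zero>\<^bsub>V\<^esub> = f \<zero>\<^bsub>V\<^esub>"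
    using linear_mapD(2)[OF assms(1), of "\<zero>\<^bsub>V\<^esub>" "\<zero>\<^bsub>V\<^esub>"] by simp
  then show ?thesis
    using linear_mapD(1)[OF assms(1), of "\<zero>\<^bsub>V\<^esub>"] by (metis V.zero_closed W.add.r_cancel_one')
qed

lemma linear_map_lspan:
  assumes f: "linear_map K V W f" and V: "left_module K V" and W: "left_module K W"
    and S: "S \<subseteq> carrier V" and T: "T \<subseteq> carrier W" and "f ` S \<subseteq> lspan K W T"
    and "x \<in> lspan K V S"
  shows "f x \<in> lspan K W T"
  using assms(7)
proof induction
  case zero
  have "f \<zero>\<^bsub>V\<^esub> = \<zero>\<^bsub>W\<^esub>"
    using linear_map_zero[OF f] V W by (simp add: left_module_def)
  then show ?case
    by (simp add: lspan.zero)
next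
  case (step a s x)
  interpret V: left_module K V by fact
  interpret W: left_module K W by fact
  have "s \<in> carrier V" "x \<in> carrier V"
    using step S V.lspan_closed by auto
  then have "f (a \<odot>\<^bsub>V\<^esub> s \<oplus>\<^bsub>V\<^esub> x) = a \<odot>\<^bsub>W\<^esub> f s \<oplus>\<^bsub>W\<^esub> f x"
    using linear_mapD[OF f] step(1) by simp
  moreover have "a \<odot>\<^bsub>W\<^esub> f s \<oplus>\<^bsub>W\<^esub> f x \<in> lspan K W T"
    using step assms(6) T by (intro W.lspan_add W.lspan_smult) auto
  ultimately show ?case
    by simp
qed

section \<open>Left ideals and the ascending chain condition\<close>

lemma left_ideal_Inter:
  assumes "ring K" "\<And>J. J \<in> F \<Longrightarrow> left_ideal J K" "F \<noteq> {}"
  shows "left_ideal (\<Inter>F) K"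
proof -
  interpret ring K by fact
  have "subgroup (\<Inter>F) (add_monoid K)"
    using assms by (intro add.subgroups_Inter) (auto simp: left_ideal_def additive_subgroup_def)
  with assms(2) show ?thesis
    by (auto simp: left_ideal_def additive_subgroup_def)
qed

lemma left_ideal_carrier: "ring K \<Longrightarrow> left_ideal (carrier K) K"
proof -
  assume "ring K"
  then interpret ring K .
  show ?thesis
    using add.subgroup_self by (auto simp: left_ideal_def additive_subgroup_def)
qed

lemma left_ideal_UN_chain:
  assumes "ring K" "\<And>k :: nat. left_ideal (I k) K" "\<And>k l. k \<le> l \<Longrightarrow> I k \<subseteq> I l"
  shows "left_ideal (\<Union>k. I k) K"
proof -
  interpret ring K by fact
  have sub: "subgroup (I k) (add_monoid K)" for k
    using assms(2) by (auto simp: left_ideal_def additive_subgroup_def)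
  have "a \<oplus>\<^bsub>K\<^esub> b \<in> (\<Union>k. I k)" if "a \<in> I k" "b \<in> I l" for a b k l
  proof -
    have "a \<in> I (max k l)" "b \<in> I (max k l)"
      using that assms(3)[of k "max k l"] assms(3)[of l "max k l"] by auto
    then show ?thesis
      using subgroup.m_closed[OF sub, of a "max k l" b] by (auto intro!: exI[of _ "max k l"])
  qed
  moreover have "(\<Union>k. I k) \<subseteq> carrier K" "\<zero>\<^bsub>K\<^esub> \<in> (\<Union>k. I k)"
    using subgroup.subset[OF sub] subgroup.one_closed[OF sub] by auto
  moreover have "inv\<^bsub>add_monoid K\<^esub> a \<in> (\<Union>k. I k)" if "a \<in> (\<Union>k. I k)" for a
    using that subgroup.m_inv_closed[OF sub] by blast
  ultimately have "subgroup (\<Union>k. I k) (add_monoid K)"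
    by unfold_locales (auto simp only: UN_iff monoid.simps partial_object.simps)
  with assms(2) show ?thesis
    by (auto simp: left_ideal_def additive_subgroup_def)
qed

text \<open>The ascending chain condition in terms of elements. \<open>I k\<close> is the left ideal
  generated by the first \<open>k\<close> terms. The union of these ideals is finitely generated, so
  it equals some \<open>I k\<close>, which then already contains the next term
  \<open>c k\<close>.\<close>

lemma left_noetherian_sequence:
  fixes c :: "nat \<Rightarrow> 'k"
  assumes K: "left_noetherian_ring K" and c: "\<And>k. c k \<in> carrier K"
  shows "\<exists>k. \<forall>J. left_ideal J K \<and> (\<forall>l<k. c l \<in> J) \<longrightarrow> c k \<in> J"
proof -
  have ring: "ring K"
    using K by (simp add: left_noetherian_ring_def)
  define I where "I k = \<Inter>{J. left_ideal J K \<and> (\<forall>l<k. c l \<in> J)}" for k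
  have ideal: "left_ideal (I k) K" for k
    unfolding I_def using c left_ideal_carrier[OF ring] by (intro left_ideal_Inter ring) auto
  have mono: "I k \<subseteq> I l" if "k \<le> l" for k l
    unfolding I_def using that by (intro Inter_anti_mono) auto
  have "left_ideal (\<Union>k. I k) K"
    using ring ideal mono by (rule left_ideal_UN_chain)
  then obtain A where A: "finite A" "(\<Union>k. I k) = \<Inter>{J. left_ideal J K \<and> A \<subseteq> J}"
    using K unfolding left_noetherian_ring_def by blast
  then have "A \<subseteq> (\<Union>k. I k)"
    by blast
  with A(1) have "\<exists>k. A \<subseteq> I k"
  proof induction
    case (insert a A)
    then obtain k l where "A \<subseteq> I k" "a \<in> I l"
      by blast
    then have "insert a A \<subseteq> I (max k l)"
      using mono[of k "max k l"] mono[of l "max k l"] by auto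
    then show ?case ..
  qed simp
  then obtain k where "A \<subseteq> I k" ..
  then have "(\<Union>k. I k) \<subseteq> I k"
    unfolding A(2) using ideal by blast
  moreover have "c k \<in> I (Suc k)"
    by (simp add: I_def)
  ultimately have "c k \<in> I k"
    by blast
  then show ?thesis
    unfolding I_def by blast
qed

section \<open>Finite rank free modules over a finite commutative ring\<close>

definition linear_functional ::
    "('r, 'd) ring_scheme \<Rightarrow> ('r, 'u) module \<Rightarrow> ('u \<Rightarrow> 'r) \<Rightarrow> bool" where
  "linear_functional R V p \<longleftrightarrow>
     p \<in> extensional (carrier V) \<and> p \<in> carrier V \<rightarrow> carrier R \<and>
     (\<forall>x\<in>carrier V. \<forall>y\<in>carrier V. p (x \<oplus>\<^bsub>V\<^esub> y) = p x \<oplus>\<^bsub>R\<^esub> p y) \<and>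
     (\<forall>a\<in>carrier R. \<forall>x\<in>carrier V. p (a \<odot>\<^bsub>V\<^esub> x) = a \<otimes>\<^bsub>R\<^esub> p x)"

text \<open>Splitting is expressed by a retraction instead of a complement, a form in which closure
  under composition is immediate.\<close>

definition split_injection ::
    "('r, 'd) ring_scheme \<Rightarrow> ('r, 'u) module \<Rightarrow> ('r, 'v) module \<Rightarrow> ('u \<Rightarrow> 'v) \<Rightarrow> bool" where
  "split_injection R V W f \<longleftrightarrow>
     linear_map R V W f \<and> (\<exists>r. linear_map R W V r \<and> (\<forall>x\<in>carrier V. r (f x) = x))"

lemma linear_map_compose:
  assumes "linear_map R U V f" "linear_map R V W g"
  shows "linear_map R U W (\<lambda>x. g (f x))"
  using assms unfolding linear_map_def by (auto simp: Pi_iff)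

lemma linear_map_cong:
  assumes "module R V" "\<And>x. x \<in> carrier V \<Longrightarrow> f x = g x"
  shows "linear_map R V W f \<longleftrightarrow> linear_map R V W g"
proof -
  interpret module R V by fact
  show ?thesis
    unfolding linear_map_def using assms(2) by (auto simp: Pi_iff)
qed

lemma linear_map_id: "linear_map R V V (\<lambda>x. x)"
  by (simp add: linear_map_def)

lemma linear_map_inverse:
  assumes f: "linear_map R V W f" and V: "module R V"
    and bij: "bij_betw f (carrier V) (carrier W)"
  shows "linear_map R W V (inv_into (carrier V) f)"
proof -
  interpret V: module R V by fact
  let ?g = "inv_into (carrier V) f"
  have g: "?g y \<in> carrier V" "f (?g y) = y" if "y \<in> carrier W" for y
    using that bij by (auto simp: bij_betw_def inv_into_into f_inv_into_f)
  have gf: "?g (f x) = x" if "x \<in> carrier V" for x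
    using that bij by (auto simp: bij_betw_def)
  have "?g (x \<oplus>\<^bsub>W\<^esub> y) = ?g x \<oplus>\<^bsub>V\<^esub> ?g y" if "x \<in> carrier W" "y \<in> carrier W" for x y
    using linear_mapD(2)[OF f, of "?g x" "?g y"] gf[of "?g x \<oplus>\<^bsub>V\<^esub> ?g y"] g that by simp
  moreover have "?g (a \<odot>\<^bsub>W\<^esub> x) = a \<odot>\<^bsub>V\<^esub> ?g x" if "a \<in> carrier R" "x \<in> carrier W" for a x
    using linear_mapD(3)[OF f, of a "?g x"] gf[of "a \<odot>\<^bsub>V\<^esub> ?g x"] g that by simp
  ultimately show ?thesis
    using g by (simp add: linear_map_def)
qed

lemma submodule_image:
  assumes f: "linear_map R V W f" and V: "module R V" and W: "module R W"
  shows "submodule (f ` carrier V) R W"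
proof -
  interpret V: module R V by fact
  interpret W: module R W by fact
  note f' = linear_mapD[OF f]
  have zero: "\<zero>\<^bsub>W\<^esub> \<in> f ` carrier V"
    using linear_map_zero[OF f V.abelian_group_axioms W.abelian_group_axioms] V.zero_closed
    by (metis imageI)
  show ?thesis
  proof (rule W.submoduleI)
    show smult: "a \<odot>\<^bsub>W\<^esub> x \<in> f ` carrier V" if "a \<in> carrier R" "x \<in> f ` carrier V" for a x
      using that f'(3)[symmetric] by auto
    show "\<ominus>\<^bsub>W\<^esub> a \<in> f ` carrier V" if "a \<in> f ` carrier V" for a
      using smult[of "\<ominus>\<^bsub>R\<^esub> \<one>\<^bsub>R\<^esub>" a] that W.smult_l_minus[of "\<one>\<^bsub>R\<^esub>" a] f'(1)
      by (metis V.R.add.inv_closed V.R.one_closed W.smult_one imageE)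
    show "a \<oplus>\<^bsub>W\<^esub> b \<in> f ` carrier V" if "a \<in> f ` carrier V" "b \<in> f ` carrier V" for a b
      using that f'(2)[symmetric] by auto
  qed (use f'(1) zero in auto)
qed

lemma submodule_kernel:
  assumes f: "linear_map R V W f" and V: "module R V" and W: "module R W"
  shows "submodule {x \<in> carrier V. f x = \<zero>\<^bsub>W\<^esub>} R V"
proof -
  interpret V: module R V by fact
  interpret W: module R W by fact
  note f' = linear_mapD[OF f]
  show ?thesis
  proof (rule V.submoduleI)
    show smult: "a \<odot>\<^bsub>V\<^esub> x \<in> {x \<in> carrier V. f x = \<zero>\<^bsub>W\<^esub>}"
      if "a \<in> carrier R" "x \<in> {x \<in> carrier V. f x = \<zero>\<^bsub>W\<^esub>}" for a x
      using that f'(3) by auto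
    show "\<ominus>\<^bsub>V\<^esub> a \<in> {x \<in> carrier V. f x = \<zero>\<^bsub>W\<^esub>}" if "a \<in> {x \<in> carrier V. f x = \<zero>\<^bsub>W\<^esub>}" for a
      using smult[of "\<ominus>\<^bsub>R\<^esub> \<one>\<^bsub>R\<^esub>" a] that V.smult_l_minus[of "\<one>\<^bsub>R\<^esub>" a] by auto
  qed (use f'(2) linear_map_zero[OF f V.abelian_group_axioms W.abelian_group_axioms] in auto)
qed

text \<open>The kernel of the retraction \<open>r\<close> is a complement: \<open>y\<close> is the
  sum of \<open>f (r y)\<close> and \<open>y - f (r y)\<close>.\<close>

lemma split_injection_direct_summand:
  assumes f: "split_injection R V W f" and V: "module R V" and W: "module R W"
  shows "direct_summand R W (f ` carrier V)"
proof -
  interpret V: module R V by fact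
  interpret W: module R W by fact
  obtain r where r: "linear_map R W V r" "\<And>x. x \<in> carrier V \<Longrightarrow> r (f x) = x"
    using f by (auto simp: split_injection_def)
  have lin: "linear_map R V W f"
    using f by (simp add: split_injection_def)
  note f' = linear_mapD[OF lin] and r' = linear_mapD[OF r(1)]
  have f0: "f \<zero>\<^bsub>V\<^esub> = \<zero>\<^bsub>W\<^esub>"
    using linear_map_zero[OF lin V.abelian_group_axioms W.abelian_group_axioms] .
  let ?B = "{y \<in> carrier W. r y = \<zero>\<^bsub>V\<^esub>}"
  have "f ` carrier V \<inter> ?B = {\<zero>\<^bsub>W\<^esub>}"
    using r(2) f0 f'(1) V.zero_closed by force
  moreover have "y \<in> f ` carrier V <+>\<^bsub>W\<^esub> ?B" if y: "y \<in> carrier W" for y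
  proof -
    have c: "r y \<in> carrier V" "f (r y) \<in> carrier W"
      using y f'(1) r'(1) by auto
    \<comment> \<open>Negation is written as scaling by -1, since \<open>linear_map\<close> speaks
      only of sums and scalar multiples.\<close>
    have neg: "\<ominus>\<^bsub>W\<^esub> f (r y) = (\<ominus>\<^bsub>R\<^esub> \<one>\<^bsub>R\<^esub>) \<odot>\<^bsub>W\<^esub> f (r y)"
      using c by (simp add: W.smult_l_minus)
    have "r (\<ominus>\<^bsub>W\<^esub> f (r y)) = \<ominus>\<^bsub>V\<^esub> r y"
      unfolding neg using c r(2) r'(3) by (simp add: V.smult_l_minus)
    then have "\<ominus>\<^bsub>W\<^esub> f (r y) \<oplus>\<^bsub>W\<^esub> y \<in> ?B"
      using y c r'(2) by (simp add: V.l_neg)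
    moreover have "y = f (r y) \<oplus>\<^bsub>W\<^esub> (\<ominus>\<^bsub>W\<^esub> f (r y) \<oplus>\<^bsub>W\<^esub> y)"
      using y c by (simp add: W.a_assoc[symmetric] W.r_neg)
    ultimately show ?thesis
      using c(1) unfolding set_add_def' by blast
  qed
  moreover have "f ` carrier V <+>\<^bsub>W\<^esub> ?B \<subseteq> carrier W"
    using f'(1) by (auto simp: set_add_def')
  ultimately show ?thesis
    unfolding direct_summand_def
    using submodule_image[OF lin V W] submodule_kernel[OF r(1) W V] by blast
qed

text \<open>Every \<open>y\<close> is \<open>f x\<close> plus an element of the complement, and
  \<open>x\<close> is unique because \<open>f\<close> is injective and the complement meets its
  image only in zero. The retraction sends \<open>y\<close> to this \<open>x\<close>; uniqueness
  also makes it linear.\<close>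

lemma split_injection_if_direct_summand:
  assumes f: "linear_map R V W f" and inj: "inj_on f (carrier V)"
    and ds: "direct_summand R W (f ` carrier V)" and V: "module R V" and W: "module R W"
  shows "split_injection R V W f"
proof -
  interpret V: module R V by fact
  interpret W: module R W by fact
  obtain B where B: "submodule B R W" "f ` carrier V \<inter> B = {\<zero>\<^bsub>W\<^esub>}"
    "f ` carrier V <+>\<^bsub>W\<^esub> B = carrier W"
    using ds by (auto simp: direct_summand_def)
  note f' = linear_mapD[OF f] and B' = submodule_simps[OF B(1)]
  have ex: "\<exists>x\<in>carrier V. \<exists>b\<in>B. y = f x \<oplus>\<^bsub>W\<^esub> b" if "y \<in> carrier W" for y
    using that unfolding B(3)[symmetric] by (auto simp: set_add_def')
  have uniq: "x = x'" if "x \<in> carrier V" "x' \<in> carrier V" "b \<in> B" "b' \<in> B"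
    "f x \<oplus>\<^bsub>W\<^esub> b = f x' \<oplus>\<^bsub>W\<^esub> b'" for x x' b b'
  proof -
    have c: "f x \<in> carrier W" "f x' \<in> carrier W" "b \<in> carrier W" "b' \<in> carrier W"
      using that f'(1) B'(1) by auto
    have neg: "\<ominus>\<^bsub>W\<^esub> f x' = (\<ominus>\<^bsub>R\<^esub> \<one>\<^bsub>R\<^esub>) \<odot>\<^bsub>W\<^esub> f x'"
      using c by (simp add: W.smult_l_minus)
    have eq: "f x \<oplus>\<^bsub>W\<^esub> \<ominus>\<^bsub>W\<^esub> f x' = b' \<oplus>\<^bsub>W\<^esub> \<ominus>\<^bsub>W\<^esub> b"
    proof -
      have "f x \<oplus>\<^bsub>W\<^esub> \<ominus>\<^bsub>W\<^esub> f x' = (f x \<oplus>\<^bsub>W\<^esub> b) \<oplus>\<^bsub>W\<^esub> (\<ominus>\<^bsub>W\<^esub> b \<oplus>\<^bsub>W\<^esub> \<ominus>\<^bsub>W\<^esub> f x')"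
        using c by (simp add: W.a_assoc) (simp add: W.a_assoc[symmetric] W.r_neg)
      also have "\<dots> = (f x' \<oplus>\<^bsub>W\<^esub> \<ominus>\<^bsub>W\<^esub> f x') \<oplus>\<^bsub>W\<^esub> (b' \<oplus>\<^bsub>W\<^esub> \<ominus>\<^bsub>W\<^esub> b)"
        unfolding that(5) using c by (simp add: W.a_ac)
      finally show ?thesis
        using c by (simp add: W.r_neg)
    qed
    have "f x \<oplus>\<^bsub>W\<^esub> \<ominus>\<^bsub>W\<^esub> f x' = f (x \<oplus>\<^bsub>V\<^esub> (\<ominus>\<^bsub>R\<^esub> \<one>\<^bsub>R\<^esub>) \<odot>\<^bsub>V\<^esub> x')"
      unfolding neg using that f' by simp
    moreover have "b' \<oplus>\<^bsub>W\<^esub> \<ominus>\<^bsub>W\<^esub> b \<in> B"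
      using that B' by simp
    ultimately have "f x \<oplus>\<^bsub>W\<^esub> \<ominus>\<^bsub>W\<^esub> f x' \<in> f ` carrier V \<inter> B"
      using that eq by auto
    then have "f x \<oplus>\<^bsub>W\<^esub> \<ominus>\<^bsub>W\<^esub> f x' = \<zero>\<^bsub>W\<^esub>"
      using B(2) by blast
    then have "f x = f x'"
      using W.minus_equality[of "f x" "\<ominus>\<^bsub>W\<^esub> f x'"] c by simp
    then show ?thesis
      using inj that by (auto dest: inj_onD)
  qed
  define r where "r y = (SOME x. x \<in> carrier V \<and> (\<exists>b\<in>B. y = f x \<oplus>\<^bsub>W\<^esub> b))" for y
  have r: "r y \<in> carrier V \<and> (\<exists>b\<in>B. y = f (r y) \<oplus>\<^bsub>W\<^esub> b)" if "y \<in> carrier W" for y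
    unfolding r_def by (rule someI_ex) (use ex[OF that] in blast)
  have rI: "r y = x" if "x \<in> carrier V" "b \<in> B" "y = f x \<oplus>\<^bsub>W\<^esub> b" for x y b
  proof -
    have "y \<in> carrier W"
      using that f'(1) B'(1) by auto
    then obtain b' where "r y \<in> carrier V" "b' \<in> B" "y = f (r y) \<oplus>\<^bsub>W\<^esub> b'"
      using r by blast
    with that show ?thesis
      by (intro uniq[of "r y" x b' b]) auto
  qed
  have "r (y \<oplus>\<^bsub>W\<^esub> z) = r y \<oplus>\<^bsub>V\<^esub> r z" if yz: "y \<in> carrier W" "z \<in> carrier W" for y z
  proof -
    obtain b c where bc: "b \<in> B" "c \<in> B" "y = f (r y) \<oplus>\<^bsub>W\<^esub> b" "z = f (r z) \<oplus>\<^bsub>W\<^esub> c"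
      using r yz by blast
    have ry: "r y \<in> carrier V" "r z \<in> carrier V"
      using r yz by auto
    then have c: "f (r y) \<in> carrier W" "f (r z) \<in> carrier W" "b \<in> carrier W" "c \<in> carrier W"
      using bc f'(1) B'(1) by auto
    have "y \<oplus>\<^bsub>W\<^esub> z = (f (r y) \<oplus>\<^bsub>W\<^esub> b) \<oplus>\<^bsub>W\<^esub> (f (r z) \<oplus>\<^bsub>W\<^esub> c)"
      using bc by simp
    also have "\<dots> = f (r y \<oplus>\<^bsub>V\<^esub> r z) \<oplus>\<^bsub>W\<^esub> (b \<oplus>\<^bsub>W\<^esub> c)"
      using c ry f'(2) by (simp add: W.a_ac)
    finally show ?thesis
      using ry bc(1,2) B' by (intro rI) auto
  qed
  moreover have "r (a \<odot>\<^bsub>W\<^esub> y) = a \<odot>\<^bsub>V\<^esub> r y" if a: "a \<in> carrier R" and y: "y \<in> carrier W" for a y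
  proof -
    obtain b where b: "b \<in> B" "y = f (r y) \<oplus>\<^bsub>W\<^esub> b"
      using r y by blast
    have ry: "r y \<in> carrier V"
      using r y by auto
    then have c: "f (r y) \<in> carrier W" "b \<in> carrier W"
      using b f'(1) B'(1) by auto
    have "a \<odot>\<^bsub>W\<^esub> y = a \<odot>\<^bsub>W\<^esub> (f (r y) \<oplus>\<^bsub>W\<^esub> b)"
      using b by simp
    also have "\<dots> = f (a \<odot>\<^bsub>V\<^esub> r y) \<oplus>\<^bsub>W\<^esub> a \<odot>\<^bsub>W\<^esub> b"
      using a c ry f'(3) by (simp add: W.smult_r_distr)
    finally show ?thesis
      using a ry b(1) B' by (intro rI) auto
  qed
  ultimately have "linear_map R W V r"
    using r by (simp add: linear_map_def)
  moreover have "r (f x) = x" if "x \<in> carrier V" for x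
    using that f'(1) B'(2) by (intro rI[of x "\<zero>\<^bsub>W\<^esub>"]) auto
  ultimately show ?thesis
    using f by (auto simp: split_injection_def)
qed

lemma split_injection_compose:
  assumes "split_injection R U V f" "split_injection R V W g"
  shows "split_injection R U W (\<lambda>x. g (f x))"
proof -
  obtain r s where "linear_map R V U r" "\<forall>x\<in>carrier U. r (f x) = x"
    "linear_map R W V s" "\<forall>x\<in>carrier V. s (g x) = x"
    using assms by (auto simp: split_injection_def)
  then show ?thesis
    using assms linear_mapD(1)[of R U V f]
    by (auto simp: split_injection_def linear_map_compose intro!: exI[of _ "\<lambda>x. r (s x)"])
qed

section \<open>Coordinate tuples inside the type of elements\<close>

text \<open>Tuples over a finite ring form a finite set, which fits into any infinite type; which
  injection is chosen is immaterial, because all computations go through \<open>vect\<close> and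
  \<open>coord\<close>.\<close>

definition encode_fun :: "('r, 'd) ring_scheme \<Rightarrow> nat \<Rightarrow> (nat \<Rightarrow> 'r) \<Rightarrow> 'u::infinite" where
  "encode_fun R n = (SOME e. inj_on e ({..<n} \<rightarrow>\<^sub>E carrier R))"

definition vect :: "('r, 'd) ring_scheme \<Rightarrow> nat \<Rightarrow> (nat \<Rightarrow> 'r) \<Rightarrow> 'u::infinite" where
  "vect R n c = encode_fun R n (restrict c {..<n})"

definition coord :: "('r, 'd) ring_scheme \<Rightarrow> nat \<Rightarrow> 'u::infinite \<Rightarrow> nat \<Rightarrow> 'r" where
  "coord R n = inv_into ({..<n} \<rightarrow>\<^sub>E carrier R) (encode_fun R n)"

definition free_mod :: "('r, 'd) ring_scheme \<Rightarrow> nat \<Rightarrow> ('r, 'u::infinite) module" where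
  "free_mod R n =
    \<lparr>carrier = encode_fun R n ` ({..<n} \<rightarrow>\<^sub>E carrier R), monoid.mult = undefined, one = undefined,
     ring.zero = vect R n (\<lambda>_. \<zero>\<^bsub>R\<^esub>), ring.add = \<lambda>x y. vect R n (\<lambda>j. coord R n x j \<oplus>\<^bsub>R\<^esub> coord R n y j),
     module.smult = \<lambda>a x. vect R n (\<lambda>j. a \<otimes>\<^bsub>R\<^esub> coord R n x j)\<rparr>"

definition tuple_map ::
    "('r, 'd) ring_scheme \<Rightarrow> ('r, 'u) module \<Rightarrow> ('u \<Rightarrow> 'r) list \<Rightarrow> 'u \<Rightarrow> 'w::infinite" where
  "tuple_map R V w = (\<lambda>x\<in>carrier V. vect R (length w) (\<lambda>j. (w ! j) x))"

definition pull_map ::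
    "('r, 'd) ring_scheme \<Rightarrow> nat \<Rightarrow> nat \<Rightarrow> (nat \<Rightarrow> nat) \<Rightarrow> 'u::infinite \<Rightarrow> 'u" where
  "pull_map R m n f = (\<lambda>x\<in>carrier (free_mod R n). vect R m (\<lambda>j. coord R n x (f j)))"

locale finite_cring = cring R for R (structure) +
  assumes finite_carrier: "finite (carrier R)"
begin

lemma inj_on_encode_fun:
  "inj_on (encode_fun R n :: _ \<Rightarrow> 'u::infinite) ({..<n} \<rightarrow>\<^sub>E carrier R)"
proof -
  have fin: "finite ({..<n} \<rightarrow>\<^sub>E carrier R)"
    using finite_carrier by (intro finite_PiE) auto
  obtain B :: "'u set" where "finite B" "card B = card ({..<n} \<rightarrow>\<^sub>E carrier R)"
    using infinite_arbitrarily_large[OF infinite_UNIV] by blast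
  with fin have "\<exists>e :: (nat \<Rightarrow> 'a) \<Rightarrow> 'u. inj_on e ({..<n} \<rightarrow>\<^sub>E carrier R)"
    using card_le_inj[of "{..<n} \<rightarrow>\<^sub>E carrier R" B] by auto
  then show ?thesis
    unfolding encode_fun_def by (rule someI_ex)
qed

lemma vect_closed:
  "(\<And>j. j < n \<Longrightarrow> c j \<in> carrier R) \<Longrightarrow> vect R n c \<in> carrier (free_mod R n)"
  by (auto simp: vect_def free_mod_def)

lemma coord_vect:
  "(\<And>j. j < n \<Longrightarrow> c j \<in> carrier R) \<Longrightarrow> j < n \<Longrightarrow> coord R n (vect R n c) j = c j"
  by (simp add: coord_def vect_def inv_into_f_f[OF inj_on_encode_fun])

lemma coord_closed:
  assumes "x \<in> carrier (free_mod R n)" "j < n"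
  shows "coord R n x j \<in> carrier R"
proof -
  have "coord R n x \<in> {..<n} \<rightarrow>\<^sub>E carrier R"
    using assms(1) unfolding coord_def free_mod_def by (intro inv_into_into) simp
  then show ?thesis
    using assms(2) by (auto simp: PiE_iff)
qed

lemma vect_coord:
  assumes "x \<in> carrier (free_mod R n)"
  shows "vect R n (coord R n x) = x"
proof -
  have "coord R n x \<in> {..<n} \<rightarrow>\<^sub>E carrier R"
    using assms unfolding coord_def free_mod_def by (intro inv_into_into) simp
  then have "restrict (coord R n x) {..<n} = coord R n x"
    by (intro extensional_restrict) (auto simp: PiE_iff)
  then show ?thesis
    using assms unfolding vect_def coord_def free_mod_def by (simp add: f_inv_into_f)
qed

lemma vect_cong: "(\<And>j. j < n \<Longrightarrow> c j = d j) \<Longrightarrow> vect R n c = vect R n d"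
  unfolding vect_def by (metis lessThan_iff restrict_ext)

lemma free_mod_eqI:
  assumes "x \<in> carrier (free_mod R n)" "y \<in> carrier (free_mod R n)"
    and "\<And>j. j < n \<Longrightarrow> coord R n x j = coord R n y j"
  shows "x = y"
  using vect_cong[of n "coord R n x" "coord R n y"] vect_coord assms by metis

lemma coord_zero: "j < n \<Longrightarrow> coord R n \<zero>\<^bsub>free_mod R n\<^esub> j = \<zero>"
  by (simp add: free_mod_def coord_vect)

lemma coord_add:
  "x \<in> carrier (free_mod R n) \<Longrightarrow> y \<in> carrier (free_mod R n) \<Longrightarrow> j < n \<Longrightarrow>
   coord R n (x \<oplus>\<^bsub>free_mod R n\<^esub> y) j = coord R n x j \<oplus> coord R n y j"
  by (subst free_mod_def) (simp add: coord_vect coord_closed)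

lemma coord_smult:
  "a \<in> carrier R \<Longrightarrow> x \<in> carrier (free_mod R n) \<Longrightarrow> j < n \<Longrightarrow>
   coord R n (a \<odot>\<^bsub>free_mod R n\<^esub> x) j = a \<otimes> coord R n x j"
  by (subst free_mod_def) (simp add: coord_vect coord_closed)

lemma free_mod_closed:
  fixes x y :: "'u::infinite"
  shows "(\<zero>\<^bsub>free_mod R n\<^esub> :: 'u) \<in> carrier (free_mod R n)"
    and "x \<in> carrier (free_mod R n) \<Longrightarrow> y \<in> carrier (free_mod R n) \<Longrightarrow>
      x \<oplus>\<^bsub>free_mod R n\<^esub> y \<in> carrier (free_mod R n)"
    and "a \<in> carrier R \<Longrightarrow> x \<in> carrier (free_mod R n) \<Longrightarrow>
      a \<odot>\<^bsub>free_mod R n\<^esub> x \<in> carrier (free_mod R n)"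
proof -
  have "\<zero>\<^bsub>free_mod R n\<^esub> = (vect R n (\<lambda>_. \<zero>) :: 'u)"
    "x \<oplus>\<^bsub>free_mod R n\<^esub> y = vect R n (\<lambda>j. coord R n x j \<oplus> coord R n y j)"
    "a \<odot>\<^bsub>free_mod R n\<^esub> x = vect R n (\<lambda>j. a \<otimes> coord R n x j)"
    by (simp_all add: free_mod_def)
  then show "(\<zero>\<^bsub>free_mod R n\<^esub> :: 'u) \<in> carrier (free_mod R n)"
    "x \<in> carrier (free_mod R n) \<Longrightarrow> y \<in> carrier (free_mod R n) \<Longrightarrow>
      x \<oplus>\<^bsub>free_mod R n\<^esub> y \<in> carrier (free_mod R n)"
    "a \<in> carrier R \<Longrightarrow> x \<in> carrier (free_mod R n) \<Longrightarrow>
      a \<odot>\<^bsub>free_mod R n\<^esub> x \<in> carrier (free_mod R n)"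
    by (simp_all add: vect_closed coord_closed)
qed

lemmas free_mod_simps = free_mod_closed coord_zero coord_add coord_smult coord_closed

lemma module_free_mod: "module R (free_mod R n :: ('a, 'u::infinite) module)"
proof (rule moduleI)
  show "abelian_group (free_mod R n :: ('a, 'u) module)"
  proof (rule abelian_groupI)
    fix x :: 'u assume x: "x \<in> carrier (free_mod R n)"
    show "\<exists>y\<in>carrier (free_mod R n). y \<oplus>\<^bsub>free_mod R n\<^esub> x = \<zero>\<^bsub>free_mod R n\<^esub>"
    proof (rule bexI)
      show neg: "(\<ominus> \<one>) \<odot>\<^bsub>free_mod R n\<^esub> x \<in> carrier (free_mod R n)"
        using x by (simp add: free_mod_simps)
      show "(\<ominus> \<one>) \<odot>\<^bsub>free_mod R n\<^esub> x \<oplus>\<^bsub>free_mod R n\<^esub> x = \<zero>\<^bsub>free_mod R n\<^esub>"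
        using x by (intro free_mod_eqI[of _ n]) (simp_all add: free_mod_simps l_minus l_neg)
    qed
  qed (simp_all add: free_mod_simps,
      (rule free_mod_eqI[of _ n]; simp add: free_mod_simps a_ac)+)
qed (simp_all add: free_mod_simps is_cring,
    (rule free_mod_eqI[of _ n]; simp add: free_mod_simps l_distr r_distr m_assoc)+)

lemma linear_map_coordwiseI:
  assumes "module R V" "\<And>x. x \<in> carrier V \<Longrightarrow> f x \<in> carrier (free_mod R n)"
    and "\<And>j x y. j < n \<Longrightarrow> x \<in> carrier V \<Longrightarrow> y \<in> carrier V \<Longrightarrow>
      coord R n (f (x \<oplus>\<^bsub>V\<^esub> y)) j = coord R n (f x) j \<oplus> coord R n (f y) j"
    and "\<And>j a x. j < n \<Longrightarrow> a \<in> carrier R \<Longrightarrow> x \<in> carrier V \<Longrightarrow>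
      coord R n (f (a \<odot>\<^bsub>V\<^esub> x)) j = a \<otimes> coord R n (f x) j"
  shows "linear_map R V (free_mod R n) f"
proof -
  interpret V: module R V by fact
  show ?thesis
    using assms(2-) by (auto simp: linear_map_def free_mod_simps intro!: free_mod_eqI)
qed

lemma finite_free_mod: "finite (carrier (free_mod R n :: ('a, 'u::infinite) module))"
  using finite_carrier by (auto simp: free_mod_def intro!: finite_PiE)

lemma coord_finsum:
  assumes "finite A" "f \<in> A \<rightarrow> carrier (free_mod R n)" "j < n"
  shows "coord R n (\<Oplus>\<^bsub>free_mod R n\<^esub>a\<in>A. f a) j = (\<Oplus>a\<in>A. coord R n (f a) j)"
proof -
  interpret E: module R "free_mod R n"
    by (rule module_free_mod)
  show ?thesis
    using assms(1,2)
  proof induction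
    case empty
    then show ?case using assms(3) by (simp add: coord_zero)
  next
    case (insert a A)
    then have "coord R n (f b) j \<in> carrier R" if "b \<in> insert a A" for b
      using that assms(3) coord_closed by blast
    moreover have "(\<Oplus>\<^bsub>free_mod R n\<^esub>a\<in>A. f a) \<in> carrier (free_mod R n)"
      using insert by (intro E.finsum_closed) auto
    ultimately show ?case
      using insert assms(3) by (simp add: Pi_iff coord_add)
  qed
qed

lemma finite_rank_free_mod: "finite_rank_free R (free_mod R n :: ('a, 'u::infinite) module)"
proof (cases "\<one> = \<zero>")
  \<comment> \<open>Over the zero ring the unit vectors coincide and cannot be indexed injectively;
    there the module is zero and has the empty basis.\<close>
  case True
  then have "carrier R = {\<zero>}"
    by (simp add: one_zeroD)
  interpret E: module R "free_mod R n :: ('a, 'u) module"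
    by (rule module_free_mod)
  have "x = \<zero>\<^bsub>free_mod R n\<^esub>" if "x \<in> carrier (free_mod R n)" for x :: 'u
    using that coord_closed[OF that] \<open>carrier R = {\<zero>}\<close>
    by (intro free_mod_eqI[of _ n]) (auto simp: free_mod_simps)
  then have "basis R (free_mod R n :: ('a, 'u) module) {}"
    by (auto simp: basis_def)
  then show ?thesis
    using module_free_mod by (auto simp: finite_rank_free_def)
next
  case False
  let ?E = "free_mod R n :: ('a, 'u) module"
  interpret E: module R ?E
    by (rule module_free_mod)
  define e :: "nat \<Rightarrow> 'u" where "e i = vect R n (\<lambda>j. if i = j then \<one> else \<zero>)" for i
  have e: "e i \<in> carrier ?E" for i
    unfolding e_def by (intro vect_closed) auto
  have coord_e: "coord R n (e i) j = (if i = j then \<one> else \<zero>)" if "j < n" for i j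
    unfolding e_def using that by (intro coord_vect) auto
  have inj: "inj_on e {..<n}"
    using coord_e False by (intro inj_onI) (metis lessThan_iff)
  have comb: "v = (\<Oplus>\<^bsub>?E\<^esub>b\<in>e ` {..<n}. c b \<odot>\<^bsub>?E\<^esub> b) \<longleftrightarrow> (\<forall>j<n. coord R n v j = c (e j))"
    if v: "v \<in> carrier ?E" and c: "c \<in> e ` {..<n} \<rightarrow> carrier R" for v c
  proof -
    have c': "c (e i) \<in> carrier R" if "i < n" for i
      using c that by auto
    have eq: "(\<Oplus>\<^bsub>?E\<^esub>b\<in>e ` {..<n}. c b \<odot>\<^bsub>?E\<^esub> b) = (\<Oplus>\<^bsub>?E\<^esub>i\<in>{..<n}. c (e i) \<odot>\<^bsub>?E\<^esub> e i)"
      using e c by (intro E.finsum_reindex inj) auto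
    have mem: "(\<Oplus>\<^bsub>?E\<^esub>i\<in>{..<n}. c (e i) \<odot>\<^bsub>?E\<^esub> e i) \<in> carrier ?E"
      using e c' by (intro E.finsum_closed) auto
    have "coord R n (\<Oplus>\<^bsub>?E\<^esub>i\<in>{..<n}. c (e i) \<odot>\<^bsub>?E\<^esub> e i) j = c (e j)" if j: "j < n" for j
    proof -
      have "coord R n (\<Oplus>\<^bsub>?E\<^esub>i\<in>{..<n}. c (e i) \<odot>\<^bsub>?E\<^esub> e i) j
          = (\<Oplus>i\<in>{..<n}. coord R n (c (e i) \<odot>\<^bsub>?E\<^esub> e i) j)"
        using e c' j by (intro coord_finsum) auto
      also have "\<dots> = (\<Oplus>i\<in>{..<n}. if j = i then c (e i) else \<zero>)"
        using e c' j by (intro finsum_cong') (auto simp: coord_smult coord_e)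
      also have "\<dots> = c (e j)"
        using j c' by (intro finsum_singleton) auto
      finally show ?thesis .
    qed
    then show ?thesis
      using eq free_mod_eqI[OF v mem] by auto
  qed
  have "\<exists>!c. c \<in> e ` {..<n} \<rightarrow>\<^sub>E carrier R \<and> v = (\<Oplus>\<^bsub>?E\<^esub>b\<in>e ` {..<n}. c b \<odot>\<^bsub>?E\<^esub> b)"
    if v: "v \<in> carrier ?E" for v
  proof
    let ?c = "\<lambda>b\<in>e ` {..<n}. coord R n v (the_inv_into {..<n} e b)"
    have inv: "the_inv_into {..<n} e (e j) = j" if "j < n" for j
      using that by (simp add: the_inv_into_f_f[OF inj])
    have "?c \<in> e ` {..<n} \<rightarrow>\<^sub>E carrier R"
      using v by (auto simp: inv coord_closed)
    with v show "?c \<in> e ` {..<n} \<rightarrow>\<^sub>E carrier R \<and> v = (\<Oplus>\<^bsub>?E\<^esub>b\<in>e ` {..<n}. ?c b \<odot>\<^bsub>?E\<^esub> b)"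
      by (subst comb) (auto simp: inv)
    fix c assume c: "c \<in> e ` {..<n} \<rightarrow>\<^sub>E carrier R \<and> v = (\<Oplus>\<^bsub>?E\<^esub>b\<in>e ` {..<n}. c b \<odot>\<^bsub>?E\<^esub> b)"
    then have "\<forall>j<n. coord R n v j = c (e j)"
      using comb[OF v, of c] by (auto simp: PiE_iff)
    with c show "c = ?c"
      by (intro extensionalityI[of _ "e ` {..<n}"]) (auto simp: PiE_iff inv)
  qed
  then have "basis R ?E (e ` {..<n})"
    using e by (auto simp: basis_def)
  then show ?thesis
    using module_free_mod by (auto simp: finite_rank_free_def)
qed

text \<open>A basis enumerated by \<open>h\<close> turns tuples into linear combinations,
  bijectively because coefficients exist and are unique. This reduces questions about arbitrary
  objects to the modules \<open>free_mod R n\<close> and shows that all objects are finite.\<close>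

lemma free_mod_iso:
  fixes V :: "('a, 'u::infinite) module"
  assumes "finite_rank_free R V"
  obtains n f g where "linear_map R V (free_mod R n :: ('a, 'u) module) f"
    "linear_map R (free_mod R n) V g"
    "\<And>x. x \<in> carrier V \<Longrightarrow> g (f x) = x" "\<And>y. y \<in> carrier (free_mod R n) \<Longrightarrow> f (g y) = y"
proof -
  obtain B where V: "module R V" and B: "basis R V B"
    using assms by (auto simp: finite_rank_free_def)
  interpret V: module R V by fact
  have fin: "finite B" and BV: "B \<subseteq> carrier V"
    using B by (auto simp: basis_def)
  define n where "n = card B"
  let ?E = "free_mod R n :: ('a, 'u) module"
  obtain h where h: "bij_betw h B {..<n}"
    using ex_bij_betw_finite_nat[OF fin] by (auto simp: n_def atLeast0LessThan)
  then have hB: "b \<in> B \<Longrightarrow> h b < n" for b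
    by (auto simp: bij_betw_def)
  define g where "g x = (\<Oplus>\<^bsub>V\<^esub>b\<in>B. coord R n x (h b) \<odot>\<^bsub>V\<^esub> b)" for x :: 'u
  have c: "coord R n x (h b) \<odot>\<^bsub>V\<^esub> b \<in> carrier V" "coord R n x (h b) \<in> carrier R" "b \<in> carrier V"
    if "x \<in> carrier ?E" "b \<in> B" for x b
    using that hB BV by (auto simp: coord_closed)
  have "g (x \<oplus>\<^bsub>?E\<^esub> y) = g x \<oplus>\<^bsub>V\<^esub> g y" if xy: "x \<in> carrier ?E" "y \<in> carrier ?E" for x y
  proof -
    have "g x \<oplus>\<^bsub>V\<^esub> g y = (\<Oplus>\<^bsub>V\<^esub>b\<in>B. coord R n x (h b) \<odot>\<^bsub>V\<^esub> b \<oplus>\<^bsub>V\<^esub> coord R n y (h b) \<odot>\<^bsub>V\<^esub> b)"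
      unfolding g_def using xy c by (intro V.finsum_addf[symmetric]) auto
    also have "\<dots> = g (x \<oplus>\<^bsub>?E\<^esub> y)"
      unfolding g_def using xy c hB
      by (intro V.finsum_cong') (auto simp: coord_add V.smult_l_distr)
    finally show ?thesis ..
  qed
  moreover have "g (a \<odot>\<^bsub>?E\<^esub> x) = a \<odot>\<^bsub>V\<^esub> g x" if ax: "a \<in> carrier R" "x \<in> carrier ?E" for a x
  proof -
    have "a \<odot>\<^bsub>V\<^esub> g x = (\<Oplus>\<^bsub>V\<^esub>b\<in>B. a \<odot>\<^bsub>V\<^esub> (coord R n x (h b) \<odot>\<^bsub>V\<^esub> b))"
      unfolding g_def using ax c fin by (intro V.finsum_smult_ldistr) auto
    also have "\<dots> = g (a \<odot>\<^bsub>?E\<^esub> x)"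
      unfolding g_def using ax c hB
      by (intro V.finsum_cong') (auto simp: coord_smult V.smult_assoc1)
    finally show ?thesis ..
  qed
  moreover have "g x \<in> carrier V" if "x \<in> carrier ?E" for x
    unfolding g_def using that c by (intro V.finsum_closed) auto
  ultimately have lin: "linear_map R ?E V g"
    by (simp add: linear_map_def)
  have restr: "g x = (\<Oplus>\<^bsub>V\<^esub>b\<in>B. (\<lambda>b\<in>B. coord R n x (h b)) b \<odot>\<^bsub>V\<^esub> b)" if "x \<in> carrier ?E" for x
    unfolding g_def using that c by (intro V.finsum_cong') auto
  have uniq: "c = d" if "c \<in> B \<rightarrow>\<^sub>E carrier R" "d \<in> B \<rightarrow>\<^sub>E carrier R"
    "(\<Oplus>\<^bsub>V\<^esub>b\<in>B. c b \<odot>\<^bsub>V\<^esub> b) = (\<Oplus>\<^bsub>V\<^esub>b\<in>B. d b \<odot>\<^bsub>V\<^esub> b)" for c d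
  proof -
    have "(\<Oplus>\<^bsub>V\<^esub>b\<in>B. c b \<odot>\<^bsub>V\<^esub> b) \<in> carrier V"
      using that(1) BV by (intro V.finsum_closed) auto
    then have "\<exists>!d. d \<in> B \<rightarrow>\<^sub>E carrier R \<and>
        (\<Oplus>\<^bsub>V\<^esub>b\<in>B. c b \<odot>\<^bsub>V\<^esub> b) = (\<Oplus>\<^bsub>V\<^esub>b\<in>B. d b \<odot>\<^bsub>V\<^esub> b)"
      using B by (simp add: basis_def)
    with that show ?thesis
      by blast
  qed
  have "inj_on g (carrier ?E)"
  proof (rule inj_onI)
    fix x y assume xy: "x \<in> carrier ?E" "y \<in> carrier ?E" "g x = g y"
    have "(\<lambda>b\<in>B. coord R n x (h b)) = (\<lambda>b\<in>B. coord R n y (h b))"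
      using xy c restr by (intro uniq) (auto simp: restrict_def)
    then have "coord R n x (h b) = coord R n y (h b)" if "b \<in> B" for b
      using that by (metis restrict_apply')
    then have "coord R n x j = coord R n y j" if "j < n" for j
      using that h by (metis bij_betw_imp_surj_on imageE lessThan_iff)
    with xy show "x = y"
      by (intro free_mod_eqI) auto
  qed
  moreover have "\<exists>x\<in>carrier ?E. v = g x" if "v \<in> carrier V" for v
  proof -
    obtain d where d: "d \<in> B \<rightarrow>\<^sub>E carrier R" "v = (\<Oplus>\<^bsub>V\<^esub>b\<in>B. d b \<odot>\<^bsub>V\<^esub> b)"
      using B \<open>v \<in> carrier V\<close> unfolding basis_def by metis
    let ?d = "\<lambda>j. d (inv_into B h j)"
    have d': "?d j \<in> carrier R" if "j < n" for j
      using that h d(1) inv_into_into[of j h B] by (auto simp: bij_betw_def PiE_iff)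
    have "g (vect R n ?d) = v"
      unfolding g_def d(2) using d(1) BV hB d' h
      by (intro V.finsum_cong') (auto simp: coord_vect bij_betw_def PiE_iff)
    with d' show ?thesis
      by (intro bexI[of _ "vect R n ?d"]) (simp_all add: vect_closed)
  qed
  ultimately have bij: "bij_betw g (carrier ?E) (carrier V)"
    using linear_mapD(1)[OF lin] by (auto simp: bij_betw_def)
  show thesis
  proof (rule that)
    show "linear_map R V ?E (inv_into (carrier ?E) g)"
      using lin module_free_mod bij by (rule linear_map_inverse)
  qed (use lin bij in \<open>auto simp: bij_betw_def f_inv_into_f\<close>)
qed

lemma finite_rank_free_finite:
  fixes V :: "('a, 'u::infinite) module"
  assumes "finite_rank_free R V"
  shows "finite (carrier V)"
proof -
  obtain n f g where f: "linear_map R V (free_mod R n :: ('a, 'u) module) f"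
    and gf: "\<And>x. x \<in> carrier V \<Longrightarrow> g (f x) = x"
    using free_mod_iso[OF assms] by metis
  then have "inj_on f (carrier V)"
    by (metis inj_onI)
  moreover have "f ` carrier V \<subseteq> carrier (free_mod R n)"
    using linear_mapD(1)[OF f] by auto
  ultimately show ?thesis
    using finite_free_mod inj_on_finite by blast
qed

lemma finite_linear_functionals:
  fixes V :: "('a, 'u::infinite) module"
  assumes "finite_rank_free R V"
  shows "finite {p. linear_functional R V p}"
proof (rule finite_subset)
  show "finite (carrier V \<rightarrow>\<^sub>E carrier R)"
    using finite_rank_free_finite[OF assms] finite_carrier by (intro finite_PiE)
qed (auto simp: linear_functional_def PiE_def)

lemma linear_map_eq_tuple_map:
  fixes g :: "'u \<Rightarrow> 'w::infinite"
  assumes V: "module R V" and g: "linear_map R V (free_mod R n) g" "g \<in> extensional (carrier V)"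
  obtains w where "length w = n" "\<And>p. p \<in> set w \<Longrightarrow> linear_functional R V p"
    "g = tuple_map R V w"
proof
  interpret V: module R V by fact
  let ?w = "map (\<lambda>j. \<lambda>x\<in>carrier V. coord R n (g x) j) [0..<n]"
  show "length ?w = n"
    by simp
  show "linear_functional R V p" if "p \<in> set ?w" for p
    using that linear_mapD[OF g(1)] by (auto simp: linear_functional_def free_mod_simps)
  show "g = tuple_map R V ?w"
  proof (rule extensionalityI[OF g(2)])
    fix x assume x: "x \<in> carrier V"
    then have gx: "g x \<in> carrier (free_mod R n)"
      using linear_mapD(1)[OF g(1)] by simp
    have "vect R n (\<lambda>j. (?w ! j) x) = (vect R n (coord R n (g x)) :: 'w)"
      using x by (intro vect_cong) simp
    with gx x show "g x = tuple_map R V ?w x"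
      by (simp add: tuple_map_def vect_coord)
  qed (simp add: tuple_map_def)
qed

text \<open>One map for several purposes: for an ordered surjection \<open>h\<close> it is
  \<open>pull_map\<close>, for a section of one it is the retraction, and for an inclusion or a
  shift it is a projection of a direct sum.\<close>

lemma linear_map_reindex:
  assumes "\<And>j. j < l \<Longrightarrow> h j < k"
  shows "linear_map R (free_mod R k) (free_mod R l) (\<lambda>x. vect R l (\<lambda>j. coord R k x (h j)))"
  using assms by (intro linear_map_coordwiseI module_free_mod)
    (auto simp: free_mod_simps vect_closed coord_vect)

text \<open>A section \<open>s\<close> of \<open>f\<close> gives the retraction: coordinate
  \<open>s k\<close> of the image is coordinate \<open>k\<close> of the argument.\<close>

lemma split_injection_pull_map:
  assumes f: "ordered_surj m n f"
  shows "split_injection R (free_mod R n) (free_mod R m) (pull_map R m n f :: 'u::infinite \<Rightarrow> 'u)"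
proof -
  let ?E = "free_mod R :: nat \<Rightarrow> ('a, 'u) module"
  have f': "f j < n" if "j < m" for j
    using that f by (auto simp: ordered_surj_def)
  obtain s where s: "\<And>k. k < n \<Longrightarrow> s k < m" "\<And>k. k < n \<Longrightarrow> f (s k) = k"
    using f unfolding ordered_surj_def by metis
  have "vect R n (\<lambda>j. coord R m (pull_map R m n f x) (s j)) = x" if "x \<in> carrier (?E n)" for x
  proof -
    have "vect R n (\<lambda>j. coord R m (pull_map R m n f x) (s j)) = (vect R n (coord R n x) :: 'u)"
      using that s f' by (intro vect_cong) (simp add: pull_map_def coord_vect coord_closed)
    with that show ?thesis
      by (simp add: vect_coord)
  qed
  moreover have "linear_map R (?E n) (?E m) (pull_map R m n f)"
    using linear_map_reindex[of m f n] f'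
    by (subst linear_map_cong[OF module_free_mod]) (auto simp: pull_map_def)
  ultimately show ?thesis
    unfolding split_injection_def using linear_map_reindex[of n s m] s(1) by blast
qed

lemma pull_map_tuple_map:
  assumes "ordered_surj m (length w) f" "\<And>p. p \<in> set w \<Longrightarrow> linear_functional R V p"
  shows "compose (carrier V) (pull_map R m (length w) f) (tuple_map R V w)
    = tuple_map R V (pull_word m f w)"
proof (rule extensionalityI)
  fix x assume x: "x \<in> carrier V"
  have c: "(w ! j) x \<in> carrier R" if "j < length w" for j
    using assms(2)[of "w ! j"] that x by (auto simp: linear_functional_def)
  have "vect R m (\<lambda>j. coord R (length w) (vect R (length w) (\<lambda>j. (w ! j) x)) (f j))
      = vect R m (\<lambda>j. (pull_word m f w ! j) x)"
    using assms(1) c by (intro vect_cong) (auto simp: ordered_surj_def coord_vect)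
  with x c show "compose (carrier V) (pull_map R m (length w) f) (tuple_map R V w) x
      = tuple_map R V (pull_word m f w) x"
    by (simp add: compose_def tuple_map_def pull_map_def vect_closed)
qed (auto simp: compose_def tuple_map_def)

end

section \<open>Representations spanned by words\<close>

lemma Ob_VI: "Ob (VI R) = {V. finite_rank_free R V}"
  and Ident_VI: "Ident (VI R) V = (\<lambda>x\<in>carrier V. x)"
  and Comp_VI: "Comp (VI R) U V W g f = compose (carrier U) g f"
  by (simp_all add: VI_def VA_def)

text \<open>For an injective linear map, a complement of the image and a linear retraction amount to
  the same; from here on VI is handled through retractions.\<close>

lemma Hom_VI:
  assumes "finite_rank_free R V" "finite_rank_free R W"
  shows "Hom (VI R) V W = {f \<in> extensional (carrier V). split_injection R V W f}"
proof -
  have V: "module R V" and W: "module R W"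
    using assms by (auto simp: finite_rank_free_def)
  have "inj_on f (carrier V)" if "split_injection R V W f" for f
    using that by (auto simp: split_injection_def inj_on_def) metis
  then have "split_injection R V W f \<longleftrightarrow> splittable R V W f \<and> inj_on f (carrier V)" for f
    using split_injection_if_direct_summand[OF _ _ _ V W, of f]
      split_injection_direct_summand[OF _ V W, of f]
    unfolding splittable_def by (metis split_injection_def)
  then show ?thesis
    by (auto simp: VI_def VA_def)
qed

lemma split_injection_restrict:
  assumes "module R V"
  shows "split_injection R V W (restrict f (carrier V)) \<longleftrightarrow> split_injection R V W f"
  using linear_map_cong[OF assms, of "restrict f (carrier V)" f W]
  by (simp add: split_injection_def)

text \<open>Retractions compose, so the proviso on composites in \<open>representation\<close>
  always holds for VI.\<close>

lemma compose_Hom_VI: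
  assumes "finite_rank_free R U" "finite_rank_free R V" "finite_rank_free R W"
    and "f \<in> Hom (VI R) U V" "g \<in> Hom (VI R) V W"
  shows "compose (carrier U) g f \<in> Hom (VI R) U W"
  using assms split_injection_compose[of R U V f W g] split_injection_restrict[of R U W "\<lambda>x. g (f x)"]
  by (auto simp: Hom_VI compose_def finite_rank_free_def)

lemma Ident_Hom_VI:
  assumes "finite_rank_free R V"
  shows "(\<lambda>x\<in>carrier V. x) \<in> Hom (VI R) V V"
  using assms split_injection_restrict[of R V V "\<lambda>x. x"] linear_map_id[of R V]
  by (auto simp: Hom_VI finite_rank_free_def split_injection_def)

lemma representationD:
  assumes "representation K C M"
  shows "x \<in> Ob C \<Longrightarrow> left_module K (obj M x)"
    and "x \<in> Ob C \<Longrightarrow> y \<in> Ob C \<Longrightarrow> f \<in> Hom C x y \<Longrightarrow>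
      linear_map K (obj M x) (obj M y) (mor M x y f)"
    and "x \<in> Ob C \<Longrightarrow> v \<in> carrier (obj M x) \<Longrightarrow> mor M x x (Ident C x) v = v"
    and "x \<in> Ob C \<Longrightarrow> y \<in> Ob C \<Longrightarrow> z \<in> Ob C \<Longrightarrow> f \<in> Hom C x y \<Longrightarrow> g \<in> Hom C y z \<Longrightarrow>
      Comp C x y z g f \<in> Hom C x z \<Longrightarrow> v \<in> carrier (obj M x) \<Longrightarrow>
      mor M x z (Comp C x y z g f) v = mor M y z g (mor M x y f v)"
  using assms unfolding representation_def by blast+

lemma subrepresentationD:
  assumes "subrepresentation K C M N" "x \<in> Ob C"
  shows "submodule (N x) K (obj M x)"
    and "y \<in> Ob C \<Longrightarrow> f \<in> Hom C x y \<Longrightarrow> v \<in> N x \<Longrightarrow> mor M x y f v \<in> N y"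
  using assms unfolding subrepresentation_def by blast+

lemma (in left_module) submodule_Int:
  assumes "submodule H R M" "submodule H' R M"
  shows "submodule (H \<inter> H') R M"
  using submodule_simps[OF assms(1)] submodule_simps[OF assms(2)]
  by (intro left_submoduleI) auto

text \<open>The generators of \<open>M\<close> lie in \<open>M (Y i)\<close>, and \<open>e i W g\<close> plays the role of the image of the
  \<open>i\<close>-th generator under \<open>g\<close>. For VA, \<open>g\<close> is an arbitrary linear map.\<close>

locale spanned_rep = finite_cring R
  for R :: "('r, 'd) ring_scheme" (structure) +
  fixes K :: "('k, 'l) ring_scheme"
    and M :: "(('r, 'u::infinite) module, 'u \<Rightarrow> 'u, 'k, 'v) rep_data"
    and r :: nat and Y :: "nat \<Rightarrow> ('r, 'u) module"
    and G :: "nat \<Rightarrow> ('r, 'u) module \<Rightarrow> ('u \<Rightarrow> 'u) set"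
    and e :: "nat \<Rightarrow> ('r, 'u) module \<Rightarrow> ('u \<Rightarrow> 'u) \<Rightarrow> 'v"
  assumes noetherian: "left_noetherian_ring K"
    and rep: "representation K (VI R) M"
    and Y: "i < r \<Longrightarrow> finite_rank_free R (Y i)"
    and G_linear: "i < r \<Longrightarrow> finite_rank_free R W \<Longrightarrow> g \<in> G i W \<Longrightarrow> linear_map R (Y i) W g"
    and G_extensional:
      "i < r \<Longrightarrow> finite_rank_free R W \<Longrightarrow> g \<in> G i W \<Longrightarrow> g \<in> extensional (carrier (Y i))"
    and e_closed: "i < r \<Longrightarrow> finite_rank_free R W \<Longrightarrow> g \<in> G i W \<Longrightarrow> e i W g \<in> carrier (obj M W)"
    and compose_G: "i < r \<Longrightarrow> finite_rank_free R W \<Longrightarrow> finite_rank_free R U \<Longrightarrow> g \<in> G i W \<Longrightarrow>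
      h \<in> Hom (VI R) W U \<Longrightarrow> compose (carrier (Y i)) h g \<in> G i U"
    and e_compose: "i < r \<Longrightarrow> finite_rank_free R W \<Longrightarrow> finite_rank_free R U \<Longrightarrow> g \<in> G i W \<Longrightarrow>
      h \<in> Hom (VI R) W U \<Longrightarrow> e i U (compose (carrier (Y i)) h g) = mor M W U h (e i W g)"
    and spanned: "finite_rank_free R W \<Longrightarrow>
      carrier (obj M W) \<subseteq> lspan K (obj M W) {e i W g |i g. i < r \<and> g \<in> G i W}"
begin

section \<open>Labels, their order and the filtration by spans\<close>

abbreviation E :: "nat \<Rightarrow> ('r, 'u) module" where
  "E n \<equiv> free_mod R n"

abbreviation ME :: "nat \<Rightarrow> ('k, 'v) module" where
  "ME n \<equiv> obj M (E n)"

definition letters :: "('u \<Rightarrow> 'r) set" where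
  "letters = (\<Union>i<r. {p. linear_functional R (Y i) p})"

text \<open>Any injection into the natural numbers will do: it gives the finite alphabet a total
  order, on which the lexicographic order is built.\<close>

definition code :: "('u \<Rightarrow> 'r) \<Rightarrow> nat" where
  "code = (SOME f. inj_on f letters)"

text \<open>Membership in \<open>G\<close> excludes, for VI, the words whose tuple map is not a
  split injection.\<close>

definition labels :: "nat \<Rightarrow> (nat \<times> ('u \<Rightarrow> 'r) list) set" where
  "labels n = {(i, w). i < r \<and> length w = n \<and> (\<forall>p\<in>set w. linear_functional R (Y i) p) \<and>
     tuple_map R (Y i) w \<in> G i (E n)}"

definition elt :: "nat \<Rightarrow> nat \<times> ('u \<Rightarrow> 'r) list \<Rightarrow> 'v" where
  "elt n = (\<lambda>(i, w). e i (E n) (tuple_map R (Y i) w))"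

text \<open>With the generator index as first entry, one lexicographic order compares indices before
  words. All keys of \<open>labels n\<close> have length \<open>n + 1\<close>, and on lists of equal
  length this order is total.\<close>

definition label_key :: "nat \<times> ('u \<Rightarrow> 'r) list \<Rightarrow> nat list" where
  "label_key = (\<lambda>(i, w). i # map code w)"

definition label_less :: "(nat \<times> ('u \<Rightarrow> 'r) list) rel" where
  "label_less = inv_image (lex less_than) label_key"

definition below :: "nat \<Rightarrow> nat \<times> ('u \<Rightarrow> 'r) list \<Rightarrow> 'v set" where
  "below n l = lspan K (ME n) (elt n ` {l' \<in> labels n. (l', l) \<in> label_less})"

definition upto_label :: "nat \<Rightarrow> nat \<times> ('u \<Rightarrow> 'r) list \<Rightarrow> 'v set" where
  "upto_label n l = lspan K (ME n) (insert (elt n l) (elt n ` {l' \<in> labels n. (l', l) \<in> label_less}))"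

lemma finite_letters: "finite letters"
  unfolding letters_def using Y by (intro finite_UN_I finite_linear_functionals) auto

lemma inj_code: "inj_on code letters"
  unfolding code_def using finite_imp_inj_to_nat_seg[OF finite_letters]
  by (intro someI_ex[of "\<lambda>f. inj_on f letters"]) blast

lemma set_label: "(i, w) \<in> labels n \<Longrightarrow> set w \<subseteq> letters"
  by (auto simp: labels_def letters_def)

lemma E_object: "finite_rank_free R (E n)"
  by (rule finite_rank_free_mod)

lemma left_module_ME: "left_module K (ME n)"
  using representationD(1)[OF rep] E_object by (simp add: Ob_VI)

lemma elt_closed: "elt n ` labels n \<subseteq> carrier (ME n)"
  using e_closed E_object by (auto simp: elt_def labels_def)

lemma label_less_trans: "trans label_less"
  unfolding label_less_def
  by (intro trans_inv_image lex_transI trans_less_than)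

lemma wf_label_less: "wf label_less"
  unfolding label_less_def by (intro wf_inv_image wf_lex wf_less_than)

lemma label_less_total:
  assumes "l \<in> labels n" "l' \<in> labels n"
  shows "l = l' \<or> (l, l') \<in> label_less \<or> (l', l) \<in> label_less"
proof -
  obtain i w i' w' where l: "l = (i, w)" "l' = (i', w')"
    by (cases l, cases l')
  have "length (label_key l) = length (label_key l')"
    using assms by (auto simp: l label_key_def labels_def)
  then have "label_key l = label_key l' \<or> (label_key l, label_key l') \<in> lex less_than \<or>
      (label_key l', label_key l) \<in> lex less_than"
    using total_lenlex[OF total_less_than] unfolding total_on_def lenlex_conv
    by (metis (no_types, lifting) UNIV_I case_prodD less_irrefl mem_Collect_eq)
  moreover have "l = l'" if "label_key l = label_key l'"
  proof -
    have "set w \<subseteq> letters" "set w' \<subseteq> letters"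
      using assms set_label unfolding l by blast+
    then have "inj_on code (set w \<union> set w')"
      using inj_code by (meson Un_least inj_on_subset)
    with that show ?thesis
      by (auto simp: l label_key_def map_inj_on)
  qed
  ultimately show ?thesis
    by (auto simp: label_less_def)
qed

lemma spanned_elt: "carrier (ME n) \<subseteq> lspan K (ME n) (elt n ` labels n)"
proof -
  have "e i (E n) g \<in> elt n ` labels n" if i: "i < r" and g: "g \<in> G i (E n)" for i g
  proof -
    have "module R (Y i)"
      using Y[OF i] by (simp add: finite_rank_free_def)
    then obtain w where "length w = n" "\<And>p. p \<in> set w \<Longrightarrow> linear_functional R (Y i) p"
      "g = tuple_map R (Y i) w"
      using linear_map_eq_tuple_map G_linear[OF i E_object g] G_extensional[OF i E_object g]
      by metis
    with i g show ?thesis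
      by (intro image_eqI[of _ _ "(i, w)"]) (auto simp: elt_def labels_def)
  qed
  then show ?thesis
    using spanned[OF E_object, of n] lspan_mono[of "{e i (E n) g |i g. i < r \<and> g \<in> G i (E n)}"
        "elt n ` labels n" K "ME n"]
    by blast
qed

text \<open>A combination involves finitely many labels and lies in the span up to the largest of
  them. The induction carries this largest label along; zero is set apart because it may involve no
  label at all.\<close>

lemma lspan_imp_upto_label:
  assumes "D \<subseteq> labels n" "y \<in> lspan K (ME n) (elt n ` D)"
  shows "y = \<zero>\<^bsub>ME n\<^esub> \<or> (\<exists>l\<in>D. y \<in> upto_label n l)"
  using assms(2)
proof induction
  case (step a s x)
  interpret ME: left_module K "ME n"
    by (rule left_module_ME)
  obtain l where l: "l \<in> D" "s = elt n l"
    using step by blast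
  have sub: "insert (elt n l') (elt n ` {l'' \<in> labels n. (l'', l') \<in> label_less}) \<subseteq> carrier (ME n)"
    if "l' \<in> D" for l'
    using that assms(1) elt_closed by blast
  note submod = submodule_simps[OF ME.submodule_lspan[OF sub], folded upto_label_def]
  note super = ME.lspan_superset[OF sub, folded upto_label_def]
  have s: "a \<odot>\<^bsub>ME n\<^esub> s \<in> upto_label n l'" if "l' \<in> D" "l = l' \<or> (l, l') \<in> label_less" for l'
    using that super[of l'] l assms(1) step(1) by (intro submod(5)) auto
  have mono: "upto_label n l1 \<subseteq> upto_label n l2" if "l1 \<in> D" "(l1, l2) \<in> label_less" for l1 l2
    unfolding upto_label_def using that assms(1) transD[OF label_less_trans]
    by (intro lspan_mono) blast
  from step.IH show ?case
  proof
    assume "x = \<zero>\<^bsub>ME n\<^esub>"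
    then show ?thesis
      using s[of l] l submod(1)[of l] by auto
  next
    assume "\<exists>l\<in>D. x \<in> upto_label n l"
    then obtain l' where l': "l' \<in> D" "x \<in> upto_label n l'"
      by blast
    consider "l = l' \<or> (l, l') \<in> label_less" | "(l', l) \<in> label_less"
      using label_less_total[of l n l'] l l' assms(1) by blast
    then show ?thesis
    proof cases
      case 1
      then show ?thesis
        using s[of l'] l' submod(3)[of l'] by blast
    next
      case 2
      then show ?thesis
        using s[of l] l l' submod(3)[of l] mono[of l' l] by blast
    qed
  qed
qed simp

section \<open>Minimal new elements and their images\<close>

text \<open>Labels exist only on the modules \<open>E n\<close>. An isomorphism from
  \<open>x\<close> to some \<open>E n\<close> and its inverse are both morphisms of VI, so a vector
  outside \<open>N0 x\<close> cannot land in \<open>N0 (E n)\<close>.\<close>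

lemma not_subset_free_mod:
  assumes N: "subrepresentation K (VI R) M N" and N0: "subrepresentation K (VI R) M N0"
    and x: "x \<in> Ob (VI R)" "\<not> N x \<subseteq> N0 x"
  shows "\<exists>n. \<not> N (E n) \<subseteq> N0 (E n)"
proof -
  have xf: "finite_rank_free R x"
    using x by (simp add: Ob_VI)
  then have mx: "module R x"
    by (simp add: finite_rank_free_def)
  obtain n f g where fg: "linear_map R x (E n) f" "linear_map R (E n) x g"
    "\<And>v. v \<in> carrier x \<Longrightarrow> g (f v) = v" "\<And>v. v \<in> carrier (E n) \<Longrightarrow> f (g v) = v"
    using free_mod_iso[OF xf] by metis
  let ?f = "restrict f (carrier x)" and ?g = "restrict g (carrier (E n))"
  have E: "E n \<in> Ob (VI R)"
    using E_object by (simp add: Ob_VI)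
  have hom: "?f \<in> Hom (VI R) x (E n)" "?g \<in> Hom (VI R) (E n) x"
    using fg split_injection_restrict[OF mx, of "E n" f]
      split_injection_restrict[OF module_free_mod, of n x g]
    by (auto simp: Hom_VI xf E_object split_injection_def)
  have comp: "Comp (VI R) x (E n) x ?g ?f = Ident (VI R) x"
    using fg linear_mapD(1)[OF fg(1)] by (auto simp: Comp_VI Ident_VI compose_def fun_eq_iff)
  obtain v where v: "v \<in> N x" "v \<notin> N0 x"
    using x by blast
  then have v': "v \<in> carrier (obj M x)"
    using submodule_simps(1)[OF subrepresentationD(1)[OF N x(1)]] by blast
  have "mor M (E n) x ?g (mor M x (E n) ?f v) = mor M x x (Comp (VI R) x (E n) x ?g ?f) v"
    using representationD(4)[OF rep x(1) E x(1) hom _ v'] Ident_Hom_VI[OF xf]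
    unfolding comp by (simp add: Ident_VI)
  then have "mor M (E n) x ?g (mor M x (E n) ?f v) = v"
    unfolding comp using representationD(3)[OF rep x(1) v'] by simp
  then have "mor M x (E n) ?f v \<notin> N0 (E n)"
    using subrepresentationD(2)[OF N0 E x(1) hom(2)] v(2) by metis
  moreover have "mor M x (E n) ?f v \<in> N (E n)"
    using subrepresentationD(2)[OF N x(1) E hom(1) v(1)] .
  ultimately show ?thesis
    by blast
qed

text \<open>For a fixed \<open>n\<close>, a minimal label is taken among those whose
  \<open>upto_label\<close> contains a vector of \<open>N\<close> outside \<open>N0\<close>. Such a
  vector in \<open>below n l\<close> would lie in \<open>upto_label\<close> of a smaller label,
  whence the last clause.\<close>

lemma minimal_element:
  assumes N: "subrepresentation K (VI R) M N" and N0: "subrepresentation K (VI R) M N0"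
    and x: "x \<in> Ob (VI R)" "\<not> N x \<subseteq> N0 x"
  shows "\<exists>n l c z. l \<in> labels n \<and> c \<in> carrier K \<and> z \<in> below n l \<and>
    c \<odot>\<^bsub>ME n\<^esub> elt n l \<oplus>\<^bsub>ME n\<^esub> z \<in> N (E n) - N0 (E n) \<and> N (E n) \<inter> below n l \<subseteq> N0 (E n)"
proof -
  obtain n where n: "\<not> N (E n) \<subseteq> N0 (E n)"
    using not_subset_free_mod[OF assms] by blast
  interpret ME: left_module K "ME n"
    by (rule left_module_ME)
  have E: "E n \<in> Ob (VI R)"
    using E_object by (simp add: Ob_VI)
  note Ns = submodule_simps[OF subrepresentationD(1)[OF N E]]
  note N0s = submodule_simps[OF subrepresentationD(1)[OF N0 E]]
  define Q where "Q = {l \<in> labels n. \<exists>y \<in> N (E n) - N0 (E n). y \<in> upto_label n l}"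
  have Q: "\<exists>l\<in>D. l \<in> Q" if "y \<in> N (E n) - N0 (E n)" "y \<in> lspan K (ME n) (elt n ` D)"
    "D \<subseteq> labels n" for y D
    using lspan_imp_upto_label[OF that(3,2)] that N0s(2) unfolding Q_def by blast
  obtain y0 where y0: "y0 \<in> N (E n) - N0 (E n)"
    using n by blast
  then have "y0 \<in> lspan K (ME n) (elt n ` labels n)"
    using Ns(1) spanned_elt by blast
  with Q[OF y0] obtain l0 where "l0 \<in> Q"
    by blast
  then obtain l where l: "l \<in> Q" "\<And>l'. (l', l) \<in> label_less \<Longrightarrow> l' \<notin> Q"
    using wfE_min[OF wf_label_less] by metis
  obtain y where y: "y \<in> N (E n) - N0 (E n)" "y \<in> upto_label n l"
    using l(1) by (auto simp: Q_def)
  have lab: "l \<in> labels n"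
    using l(1) by (simp add: Q_def)
  have "insert (elt n l) (elt n ` {l' \<in> labels n. (l', l) \<in> label_less}) \<subseteq> carrier (ME n)"
    using lab elt_closed by blast
  then obtain c z where "c \<in> carrier K" "z \<in> below n l" "y = c \<odot>\<^bsub>ME n\<^esub> elt n l \<oplus>\<^bsub>ME n\<^esub> z"
    using ME.lspan_insert y(2) unfolding upto_label_def below_def by blast
  moreover have "N (E n) \<inter> below n l \<subseteq> N0 (E n)"
    using Q[of _ "{l' \<in> labels n. (l', l) \<in> label_less}"] l(2) unfolding below_def by blast
  ultimately show ?thesis
    using lab y(1) by blast
qed

text \<open>The label order is preserved because unequal indices decide it as before and equal ones
  leave it to \<open>lex_pull_word\<close>. An expression with top label \<open>(i, w)\<close> is
  thus carried to one with the pulled-back label on top and the same coefficient.\<close>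

lemma pull_elt:
  assumes f: "ordered_surj m n f" and l: "(i, w) \<in> labels n"
  shows "(i, pull_word m f w) \<in> labels m"
    and "mor M (E n) (E m) (pull_map R m n f) (elt n (i, w)) = elt m (i, pull_word m f w)"
    and "(l', (i, w)) \<in> label_less \<Longrightarrow> l' \<in> labels n \<Longrightarrow>
      ((fst l', pull_word m f (snd l')), (i, pull_word m f w)) \<in> label_less"
proof -
  have iw: "i < r" "length w = n" "\<And>p. p \<in> set w \<Longrightarrow> linear_functional R (Y i) p"
    "tuple_map R (Y i) w \<in> G i (E n)"
    using l by (auto simp: labels_def)
  have h: "pull_map R m n f \<in> Hom (VI R) (E n) (E m)"
    using split_injection_pull_map[OF f] by (simp add: Hom_VI E_object pull_map_def)
  have comp: "compose (carrier (Y i)) (pull_map R m n f) (tuple_map R (Y i) w)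
      = tuple_map R (Y i) (pull_word m f w)"
    using pull_map_tuple_map[of m w f "Y i"] f iw(2,3) by simp
  show "(i, pull_word m f w) \<in> labels m"
    using compose_G[OF iw(1) E_object E_object iw(4) h] iw set_pull_word[of m w f] f
    unfolding comp by (auto simp: labels_def)
  show "mor M (E n) (E m) (pull_map R m n f) (elt n (i, w)) = elt m (i, pull_word m f w)"
    using e_compose[OF iw(1) E_object E_object iw(4) h] unfolding comp by (simp add: elt_def)
  assume l': "(l', (i, w)) \<in> label_less" "l' \<in> labels n"
  obtain i' w' where iw': "l' = (i', w')"
    by (cases l')
  then have len: "length w' = n"
    using l' by (simp add: labels_def)
  have map: "map code (pull_word m f u) = pull_word m f (map code u)" if "length u = n" for u
    using f that by (auto simp: pull_word_def ordered_surj_def)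
  show "((fst l', pull_word m f (snd l')), (i, pull_word m f w)) \<in> label_less"
    using l' lex_pull_word[OF f, of "map code w'" "map code w"] len iw(2)
    by (auto simp: label_less_def label_key_def iw' map)
qed

text \<open>The subrepresentation generated by the earlier elements is never formed. Each stage uses
  some \<open>N0\<close>, provided by the negated claim, that contains the earlier elements but not
  all of \<open>N\<close>, and takes a minimal new element relative to it.\<close>

theorem subrepresentation_generated:
  assumes N: "subrepresentation K (VI R) M N"
  shows "\<exists>S \<subseteq> (SIGMA x:Ob (VI R). N x). finite S \<and>
    (\<forall>N0. subrepresentation K (VI R) M N0 \<and> (\<forall>(x, v)\<in>S. v \<in> N0 x) \<longrightarrow>
      (\<forall>x\<in>Ob (VI R). N x \<subseteq> N0 x))"
proof (rule ccontr)
  assume neg: "\<not> ?thesis"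
  \<comment> \<open>A stage is the tuple of the rank \<open>n\<close>, the label, the leading
    coefficient, the lower part and the subrepresentation \<open>N0\<close>, so that one choice
    supplies all of them.\<close>
  define y where "y = (\<lambda>(n, l, c, z, N0 :: ('r, 'u) module \<Rightarrow> 'v set).
    c \<odot>\<^bsub>ME n\<^esub> elt n l \<oplus>\<^bsub>ME n\<^esub> z)"
  define pt where "pt = (\<lambda>t. (E (fst t), y t))"
  define good where "good = (\<lambda>(n, l, c, z, N0). subrepresentation K (VI R) M N0 \<and>
    l \<in> labels n \<and> c \<in> carrier K \<and> z \<in> below n l \<and>
    y (n, l, c, z, N0) \<in> N (E n) - N0 (E n) \<and> N (E n) \<inter> below n l \<subseteq> N0 (E n))"
  define step where "step S t \<longleftrightarrow> good t \<and> (\<forall>(x, v)\<in>S. v \<in> snd (snd (snd (snd t))) x)" for S t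
  have ex: "\<exists>t. step S t" if S: "S \<subseteq> (SIGMA x:Ob (VI R). N x)" "finite S" for S
  proof -
    have "\<not> (\<forall>N0. subrepresentation K (VI R) M N0 \<and> (\<forall>(x, v)\<in>S. v \<in> N0 x) \<longrightarrow>
      (\<forall>x\<in>Ob (VI R). N x \<subseteq> N0 x))"
      using neg S by (intro notI) (rule notE, assumption, intro exI[of _ S] conjI)
    then obtain N0 x where "subrepresentation K (VI R) M N0" "\<forall>(x, v)\<in>S. v \<in> N0 x"
      "x \<in> Ob (VI R)" "\<not> N x \<subseteq> N0 x"
      by blast
    moreover from this obtain n l c z where "l \<in> labels n" "c \<in> carrier K" "z \<in> below n l"
      "c \<odot>\<^bsub>ME n\<^esub> elt n l \<oplus>\<^bsub>ME n\<^esub> z \<in> N (E n) - N0 (E n)" "N (E n) \<inter> below n l \<subseteq> N0 (E n)"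
      using minimal_element[OF N] by metis
    ultimately have "step S (n, l, c, z, N0)"
      by (auto simp: step_def good_def y_def)
    then show ?thesis ..
  qed
  \<comment> \<open>Each choice depends on all earlier ones, so the recursion builds the list of
    stages so far, and \<open>t k\<close> is its newest entry.\<close>
  define L where "L = rec_nat [] (\<lambda>_ ts. ts @ [SOME t. step (pt ` set ts) t])"
  define t where "t k = last (L (Suc k))" for k
  have L: "L k = map t [0..<k]" for k
    by (induction k) (simp_all add: L_def t_def)
  have t_eq: "t k = (SOME t'. step (pt ` t ` {..<k}) t')" for k
  proof -
    have "t k = (SOME t'. step (pt ` set (L k)) t')"
      by (simp add: t_def L_def)
    then show ?thesis
      by (simp add: L atLeast0LessThan)
  qed
  have pt_good: "pt t' \<in> (SIGMA x:Ob (VI R). N x)" if "good t'" for t'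
    using that E_object by (cases t') (auto simp: good_def pt_def Ob_VI)
  \<comment> \<open>The choice is justified only once all earlier points are known to lie in
    \<open>N\<close>, hence strong induction.\<close>
  have t: "step (pt ` t ` {..<k}) (t k)" for k
  proof (induction k rule: less_induct)
    case (less k)
    then have "pt (t j) \<in> (SIGMA x:Ob (VI R). N x)" if "j < k" for j
      using that by (intro pt_good) (simp add: step_def)
    then have "pt ` t ` {..<k} \<subseteq> (SIGMA x:Ob (VI R). N x)"
      by blast
    then have "\<exists>t'. step (pt ` t ` {..<k}) t'"
      by (rule ex) simp
    then show ?case
      unfolding t_eq[of k] by (rule someI_ex)
  qed
  define n where "n k = fst (t k)" for k
  define i where "i k = fst (fst (snd (t k)))" for k
  define w where "w k = snd (fst (snd (t k)))" for k
  define c where "c k = fst (snd (snd (t k)))" for k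
  define z where "z k = fst (snd (snd (snd (t k))))" for k
  define N0 where "N0 k = snd (snd (snd (snd (t k))))" for k
  have tk: "t k = (n k, (i k, w k), c k, z k, N0 k)" for k
    by (simp add: n_def i_def w_def c_def z_def N0_def)
  define v where "v k = y (t k)" for k
  have v: "v k = c k \<odot>\<^bsub>ME (n k)\<^esub> elt (n k) (i k, w k) \<oplus>\<^bsub>ME (n k)\<^esub> z k" for k
    by (simp add: v_def y_def tk)
  have g: "subrepresentation K (VI R) M (N0 k)" "(i k, w k) \<in> labels (n k)" "c k \<in> carrier K"
    "z k \<in> below (n k) (i k, w k)" "v k \<in> N (E (n k))" "v k \<notin> N0 k (E (n k))"
    "N (E (n k)) \<inter> below (n k) (i k, w k) \<subseteq> N0 k (E (n k))" for k
    using t[of k] by (auto simp: step_def good_def v_def tk)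
  have earlier: "v j \<in> N0 k (E (n j))" if "j < k" for j k
    using t[of k] that by (auto simp: step_def pt_def v_def n_def N0_def)
  have len: "length (w k) = n k" and ir: "i k < r" for k
    using g(2)[of k] by (auto simp: labels_def)
  \<comment> \<open>There are finitely many generators. Their index is made constant first, because
    \<open>pull_map\<close> changes the word of a label but keeps its index.\<close>
  obtain r0 :: "nat \<Rightarrow> nat" and i0 where r0: "strict_mono r0" "\<And>k. i (r0 k) = i0"
    using subsequence_constant[of "{..<r}" i] ir by auto
  have "has_chains word_le {w. set w \<subseteq> letters}"
    using finite_letters by (rule word_le_chains)
  moreover have "w (r0 k) \<in> {w. set w \<subseteq> letters}" for k
    using set_label[OF g(2)] by simp
  ultimately obtain r1 :: "nat \<Rightarrow> nat"
    where r1: "strict_mono r1" "\<And>j k. j < k \<Longrightarrow> word_le (w (r0 (r1 j))) (w (r0 (r1 k)))"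
    using has_chainsD[of word_le _ "\<lambda>k. w (r0 k)"] by blast
  define q where "q k = r0 (r1 k)" for k
  have q: "q j < q k" "i (q j) = i (q k)" "word_le (w (q j)) (w (q k))" if "j < k" for j k
    using that r0 r1 by (auto simp: q_def strict_mono_def)
  \<comment> \<open>Stage \<open>q k\<close> is the one to be contradicted: its leading coefficient
    lies in every left ideal containing those of the earlier stages of the chain.\<close>
  obtain k where k: "\<And>J. left_ideal J K \<Longrightarrow> (\<And>j. j < k \<Longrightarrow> c (q j) \<in> J) \<Longrightarrow> c (q k) \<in> J"
    using left_noetherian_sequence[OF noetherian, of "\<lambda>k. c (q k)"] g(3) by blast
  let ?m = "n (q k)" and ?l = "(i (q k), w (q k))"
  interpret ME: left_module K "ME ?m"
    by (rule left_module_ME)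
  have Ob: "E m \<in> Ob (VI R)" for m
    using E_object by (simp add: Ob_VI)
  have N0s: "submodule (N0 (q k) (E ?m)) K (ME ?m)" and Ns: "submodule (N (E ?m)) K (ME ?m)"
    using subrepresentationD(1)[OF g(1) Ob] subrepresentationD(1)[OF N Ob] by auto
  have below_closed: "elt ?m ` {l' \<in> labels ?m. (l', ?l) \<in> label_less} \<subseteq> carrier (ME ?m)"
    using elt_closed by blast
  have Fs: "submodule (below ?m ?l) K (ME ?m)"
    unfolding below_def using below_closed by (rule ME.submodule_lspan)
  \<comment> \<open>\<open>N0 (q k)\<close> need not lie inside \<open>N\<close>; the intersection
    ensures that the cancelling vector belongs to both.\<close>
  define H where "H = N0 (q k) (E ?m) \<inter> N (E ?m)"
  have Hs: "submodule H K (ME ?m)"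
    unfolding H_def using N0s Ns by (rule ME.submodule_Int)
  have elt: "elt ?m ?l \<in> carrier (ME ?m)"
    using elt_closed g(2) by blast
  define J where "J = {d \<in> carrier K. \<exists>z\<in>below ?m ?l. d \<odot>\<^bsub>ME ?m\<^esub> elt ?m ?l \<oplus>\<^bsub>ME ?m\<^esub> z \<in> H}"
  have "left_ideal J K"
    unfolding J_def using Hs Fs elt by (rule ME.left_ideal_leading_coefficients)
  \<comment> \<open>The vector of stage \<open>q j\<close> lies in \<open>N0 (q k)\<close>, and its
    image under \<open>pull_map\<close> has the label of stage \<open>q k\<close> on top, still with
    coefficient \<open>c (q j)\<close>.\<close>
  moreover have "c (q j) \<in> J" if "j < k" for j
  proof -
    let ?n = "n (q j)" and ?l' = "(i (q j), w (q j))"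
    obtain f where f: "ordered_surj ?m ?n f" "w (q k) = pull_word ?m f (w (q j))"
      using q(3)[OF \<open>j < k\<close>] by (auto simp: word_le_def len)
    let ?h = "mor M (E ?n) (E ?m) (pull_map R ?m ?n f)"
    have hom: "pull_map R ?m ?n f \<in> Hom (VI R) (E ?n) (E ?m)"
      using split_injection_pull_map[OF f(1)] by (simp add: Hom_VI E_object pull_map_def)
    have lin: "linear_map K (ME ?n) (ME ?m) ?h"
      using representationD(2)[OF rep Ob Ob hom] .
    note pull = pull_elt[OF f(1) g(2)]
    have elt_j: "elt ?n ?l' \<in> carrier (ME ?n)"
      using elt_closed g(2) by blast
    have sub_j: "elt ?n ` {l' \<in> labels ?n. (l', ?l') \<in> label_less} \<subseteq> carrier (ME ?n)"
      using elt_closed by blast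
    have "?h (elt ?n l') \<in> below ?m ?l" if l': "l' \<in> labels ?n" "(l', ?l') \<in> label_less" for l'
    proof -
      have "?h (elt ?n l') = elt ?m (fst l', pull_word ?m f (snd l'))"
        "(fst l', pull_word ?m f (snd l')) \<in> labels ?m"
        using pull_elt(1,2)[OF f(1), of "fst l'" "snd l'"] l'(1) by auto
      moreover have "((fst l', pull_word ?m f (snd l')), ?l) \<in> label_less"
        using pull(3)[OF l'(2,1)] q(2)[OF \<open>j < k\<close>] f(2) by simp
      ultimately show ?thesis
        unfolding below_def using ME.lspan_superset[OF below_closed] by auto
    qed
    then have hz: "?h (z (q j)) \<in> below ?m ?l"
      using linear_map_lspan[OF lin left_module_ME left_module_ME sub_j below_closed]
        g(4)[of "q j"] unfolding below_def by blast
    interpret MEj: left_module K "ME ?n"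
      by (rule left_module_ME)
    have zj: "z (q j) \<in> carrier (ME ?n)"
      using g(4)[of "q j"] MEj.lspan_closed[OF sub_j] unfolding below_def by blast
    have "?h (v (q j)) = c (q j) \<odot>\<^bsub>ME ?m\<^esub> elt ?m ?l \<oplus>\<^bsub>ME ?m\<^esub> ?h (z (q j))"
      unfolding v using linear_mapD[OF lin] elt_j zj g(3) pull(2) f(2) q(2)[OF that] by simp
    moreover have "?h (v (q j)) \<in> H"
      unfolding H_def
      using subrepresentationD(2)[OF g(1) Ob Ob hom earlier[OF q(1)[OF that]]]
        subrepresentationD(2)[OF N Ob Ob hom g(5)] by simp
    ultimately show ?thesis
      unfolding J_def using g(3) hz by auto
  qed
  ultimately have "c (q k) \<in> J"
    by (rule k)
  then obtain z' where z': "z' \<in> below ?m ?l"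
    "c (q k) \<odot>\<^bsub>ME ?m\<^esub> elt ?m ?l \<oplus>\<^bsub>ME ?m\<^esub> z' \<in> H"
    by (auto simp: J_def)
  define v' where "v' = c (q k) \<odot>\<^bsub>ME ?m\<^esub> elt ?m ?l \<oplus>\<^bsub>ME ?m\<^esub> z'"
  have v': "v' \<in> N0 (q k) (E ?m)" "v' \<in> N (E ?m)"
    using z'(2) by (auto simp: H_def v'_def)
  have closed: "z (q k) \<in> carrier (ME ?m)" "z' \<in> carrier (ME ?m)"
    "v' \<in> carrier (ME ?m)" "v (q k) \<in> carrier (ME ?m)"
    using submodule_simps(1)[OF Fs] submodule_simps(1)[OF Ns] g(4,5) z'(1) v'(2) by auto
  have a: "c (q k) \<odot>\<^bsub>ME ?m\<^esub> elt ?m ?l \<in> carrier (ME ?m)"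
    using g(3) elt by simp
  \<comment> \<open>The leading terms cancel, so the difference lies in the span of smaller labels,
    where minimality has left no vector of \<open>N\<close> outside \<open>N0 (q k)\<close>.\<close>
  have "v (q k) \<oplus>\<^bsub>ME ?m\<^esub> \<ominus>\<^bsub>ME ?m\<^esub> v' = z (q k) \<oplus>\<^bsub>ME ?m\<^esub> \<ominus>\<^bsub>ME ?m\<^esub> z'"
    unfolding v[of "q k"] v'_def using a closed(1,2)
    by (simp add: ME.minus_add ME.a_ac ME.r_neg ME.r_neg1 ME.r_neg2)
  then have "v (q k) \<oplus>\<^bsub>ME ?m\<^esub> \<ominus>\<^bsub>ME ?m\<^esub> v' \<in> below ?m ?l"
    using submodule_simps[OF Fs] g(4) z'(1) by simp
  moreover have "v (q k) \<oplus>\<^bsub>ME ?m\<^esub> \<ominus>\<^bsub>ME ?m\<^esub> v' \<in> N (E ?m)"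
    using submodule_simps[OF Ns] g(5) v'(2) by simp
  ultimately have "(v (q k) \<oplus>\<^bsub>ME ?m\<^esub> \<ominus>\<^bsub>ME ?m\<^esub> v') \<oplus>\<^bsub>ME ?m\<^esub> v' \<in> N0 (q k) (E ?m)"
    using g(7) v'(1) submodule_simps(3)[OF N0s] by blast
  then have "v (q k) \<in> N0 (q k) (E ?m)"
    using closed by (simp add: ME.a_assoc ME.l_neg)
  then show False
    using g(6) by simp
qed

end

section \<open>Noetherianity of VI\<close>

text \<open>A subrepresentation of \<open>restrict_rep M N\<close> is one of \<open>M\<close>
  contained in \<open>N\<close>, so generation of \<open>N\<close> may be tested against the
  subrepresentations of \<open>M\<close>, whether or not they lie in \<open>N\<close>.\<close>

lemma finitely_generated_restrict_rep:
  assumes rep: "representation K C M" and N: "subrepresentation K C M N"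
    and gen: "\<exists>S \<subseteq> (SIGMA x:Ob C. N x). finite S \<and>
      (\<forall>N0. subrepresentation K C M N0 \<and> (\<forall>(x, v)\<in>S. v \<in> N0 x) \<longrightarrow> (\<forall>x\<in>Ob C. N x \<subseteq> N0 x))"
  shows "finitely_generated_rep K C (restrict_rep M N)"
proof -
  obtain S where S: "S \<subseteq> (SIGMA x:Ob C. N x)" "finite S"
    "\<And>N0 x. subrepresentation K C M N0 \<Longrightarrow> \<forall>(x, v)\<in>S. v \<in> N0 x \<Longrightarrow> x \<in> Ob C \<Longrightarrow> N x \<subseteq> N0 x"
    using gen by metis
  have obj: "obj (restrict_rep M N) x = (obj M x)\<lparr>carrier := N x\<rparr>"
    and mor: "mor (restrict_rep M N) = mor M" for x
    by (simp_all add: restrict_rep_def)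
  have "N0 x = N x" if N0: "subrepresentation K C (restrict_rep M N) N0"
    and SN0: "\<forall>(x, v)\<in>S. v \<in> N0 x" and x: "x \<in> Ob C" for N0 x
  proof -
    have sub: "submodule (N0 y) K (obj M y)" "N0 y \<subseteq> N y" if y: "y \<in> Ob C" for y
    proof -
      interpret left_module K "obj M y"
        using representationD(1)[OF rep y] .
      note N0s = submodule_simps[OF subrepresentationD(1)[OF N0 y], unfolded obj, simplified]
      note Ns = submodule_simps[OF subrepresentationD(1)[OF N y]]
      show "N0 y \<subseteq> N y"
        using N0s(1) .
      then show "submodule (N0 y) K (obj M y)"
        using N0s(2,3,5) Ns(1) by (intro left_submoduleI) auto
    qed
    have "subrepresentation K C M N0"
      using sub(1) subrepresentationD(2)[OF N0] unfolding subrepresentation_def mor by blast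
    then show ?thesis
      using S(3)[OF _ SN0 x] sub(2)[OF x] by blast
  qed
  then show ?thesis
    unfolding finitely_generated_rep_def using S(1,2) obj by (intro exI[of _ S]) simp
qed

lemma finite_generators_list:
  assumes "finitely_generated_rep K C M"
  obtains xs where "set xs \<subseteq> (SIGMA x:Ob C. carrier (obj M x))"
    "\<And>N x. subrepresentation K C M N \<Longrightarrow> (\<And>i. i < length xs \<Longrightarrow> snd (xs ! i) \<in> N (fst (xs ! i))) \<Longrightarrow>
      x \<in> Ob C \<Longrightarrow> N x = carrier (obj M x)"
proof -
  obtain S where S: "S \<subseteq> (SIGMA x:Ob C. carrier (obj M x))" "finite S"
    "\<And>N x. subrepresentation K C M N \<Longrightarrow> \<forall>(x, v)\<in>S. v \<in> N x \<Longrightarrow> x \<in> Ob C \<Longrightarrow>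
      N x = carrier (obj M x)"
    using assms unfolding finitely_generated_rep_def by metis
  obtain xs where xs: "set xs = S"
    using finite_list[OF S(2)] by blast
  show thesis
  proof (rule that)
    show "set xs \<subseteq> (SIGMA x:Ob C. carrier (obj M x))"
      using S(1) xs by simp
    fix N x assume *: "subrepresentation K C M N"
      "\<And>i. i < length xs \<Longrightarrow> snd (xs ! i) \<in> N (fst (xs ! i))" "x \<in> Ob C"
    have "\<forall>(x, v)\<in>S. v \<in> N x"
      using *(2) unfolding xs[symmetric] by (auto simp: in_set_conv_nth) (metis fst_conv snd_conv)
    with S(3) *(1,3) show "N x = carrier (obj M x)"
      by blast
  qed
qed

lemma subrepresentation_lspan:
  assumes rep: "representation K C M"
    and S: "\<And>x. x \<in> Ob C \<Longrightarrow> S x \<subseteq> carrier (obj M x)"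
    and mor: "\<And>x y f s. x \<in> Ob C \<Longrightarrow> y \<in> Ob C \<Longrightarrow> f \<in> Hom C x y \<Longrightarrow> s \<in> S x \<Longrightarrow> mor M x y f s \<in> S y"
  shows "subrepresentation K C M (\<lambda>x. lspan K (obj M x) (S x))"
proof -
  have "submodule (lspan K (obj M x) (S x)) K (obj M x)" if "x \<in> Ob C" for x
    using left_module.submodule_lspan[OF representationD(1)[OF rep that] S[OF that]] .
  moreover have "mor M x y f ` lspan K (obj M x) (S x) \<subseteq> lspan K (obj M y) (S y)"
    if xyf: "x \<in> Ob C" "y \<in> Ob C" "f \<in> Hom C x y" for x y f
  proof -
    have "mor M x y f ` S x \<subseteq> lspan K (obj M y) (S y)"
      using mor[OF xyf] left_module.lspan_superset[OF representationD(1)[OF rep xyf(2)] S[OF xyf(2)]]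
      by blast
    then show ?thesis
      using linear_map_lspan[OF representationD(2)[OF rep xyf] representationD(1)[OF rep xyf(1)]
          representationD(1)[OF rep xyf(2)] S[OF xyf(1)] S[OF xyf(2)]] by blast
  qed
  ultimately show ?thesis
    by (simp add: subrepresentation_def)
qed

text \<open>The spans of the images of the generators under VI form a subrepresentation, because VI
  is closed under composition, and the identities put the generators into it. Hence they exhaust
  \<open>M\<close>, as \<open>spanned_rep\<close> requires.\<close>

lemma (in finite_cring) Rep_noetherian_VI:
  assumes K: "left_noetherian_ring K"
  shows "Rep_noetherian TYPE('v) K (VI R :: (('a, 'u::infinite) module, 'u \<Rightarrow> 'u) cat_data)"
  unfolding Rep_noetherian_def
proof (intro allI impI, elim conjE)
  fix M :: "(('a, 'u) module, 'u \<Rightarrow> 'u, 'c, 'v) rep_data" and N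
  assume rep: "representation K (VI R) M" and fg: "finitely_generated_rep K (VI R) M"
    and N: "subrepresentation K (VI R) M N"
  obtain xs where xs: "set xs \<subseteq> (SIGMA x:Ob (VI R). carrier (obj M x))"
    and gen: "\<And>N x. subrepresentation K (VI R) M N \<Longrightarrow>
      (\<And>i. i < length xs \<Longrightarrow> snd (xs ! i) \<in> N (fst (xs ! i))) \<Longrightarrow>
      x \<in> Ob (VI R) \<Longrightarrow> N x = carrier (obj M x)"
    using finite_generators_list[OF fg] by metis
  define Y where "Y i = fst (xs ! i)" for i
  define v where "v i = snd (xs ! i)" for i
  have Yv: "finite_rank_free R (Y i)" "v i \<in> carrier (obj M (Y i))" if "i < length xs" for i
    using nth_mem[OF that] xs by (auto simp: Y_def v_def Ob_VI)
  define G where "G i W = Hom (VI R) (Y i) W" for i W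
  define e where "e i W g = mor M (Y i) W g (v i)" for i W g
  define S where "S W = {e i W g |i g. i < length xs \<and> g \<in> G i W}" for W
  have Ob: "W \<in> Ob (VI R) \<longleftrightarrow> finite_rank_free R W" for W :: "('a, 'u) module"
    by (simp add: Ob_VI)
  have e_closed: "e i W g \<in> carrier (obj M W)"
    if "i < length xs" "finite_rank_free R W" "g \<in> G i W" for i W g
    using linear_mapD(1)[OF representationD(2)[OF rep]] that Yv by (simp add: e_def G_def Ob)
  have compose_G: "compose (carrier (Y i)) h g \<in> G i U"
    and e_compose: "e i U (compose (carrier (Y i)) h g) = mor M W U h (e i W g)"
    if "i < length xs" "finite_rank_free R W" "finite_rank_free R U" "g \<in> G i W" "h \<in> Hom (VI R) W U"
    for i W U g h
  proof -
    show c: "compose (carrier (Y i)) h g \<in> G i U"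
      using compose_Hom_VI[OF Yv(1) that(2,3)] that by (simp add: G_def)
    show "e i U (compose (carrier (Y i)) h g) = mor M W U h (e i W g)"
      using representationD(4)[OF rep, of "Y i" W U g h "v i"] that Yv c
      by (simp add: Ob G_def e_def Comp_VI)
  qed
  have sub: "subrepresentation K (VI R) M (\<lambda>W. lspan K (obj M W) (S W))"
  proof (rule subrepresentation_lspan[OF rep])
    show "S W \<subseteq> carrier (obj M W)" if "W \<in> Ob (VI R)" for W
      using that e_closed by (auto simp: S_def Ob)
    show "mor M W U h s \<in> S U"
      if "W \<in> Ob (VI R)" "U \<in> Ob (VI R)" "h \<in> Hom (VI R) W U" "s \<in> S W" for W U h s
    proof -
      obtain i g where ig: "i < length xs" "g \<in> G i W" "s = e i W g"
        using \<open>s \<in> S W\<close> by (auto simp: S_def)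
      with that show ?thesis
        using compose_G e_compose unfolding S_def Ob by (metis (mono_tags, lifting) mem_Collect_eq)
    qed
  qed
  have "v i \<in> lspan K (obj M (Y i)) (S (Y i))" if i: "i < length xs" for i
  proof -
    have "v i = e i (Y i) (Ident (VI R) (Y i))"
      using representationD(3)[OF rep] Yv[OF i] by (simp add: e_def Ob)
    then have "v i \<in> S (Y i)"
      using Ident_Hom_VI[OF Yv(1)[OF i]] i by (auto simp: S_def G_def Ident_VI)
    moreover have "S (Y i) \<subseteq> carrier (obj M (Y i))"
      using e_closed Yv(1)[OF i] by (auto simp: S_def)
    then have "S (Y i) \<subseteq> lspan K (obj M (Y i)) (S (Y i))"
      using Yv(1)[OF i] Ob by (intro left_module.lspan_superset representationD(1)[OF rep]) auto
    ultimately show ?thesis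
      by blast
  qed
  then have span: "lspan K (obj M W) (S W) = carrier (obj M W)" if "finite_rank_free R W" for W
    using gen[OF sub] that by (simp add: Ob Y_def v_def)
  interpret words: spanned_rep R K M "length xs" Y G e
  proof unfold_locales
    show "linear_map R (Y i) W g" "g \<in> extensional (carrier (Y i))"
      if "i < length xs" "finite_rank_free R W" "g \<in> G i W" for i W g
      using that Yv by (auto simp: G_def Hom_VI split_injection_def)
  qed (use K rep Yv e_closed compose_G e_compose span in \<open>auto simp: S_def\<close>)
  show "finitely_generated_rep K (VI R) (restrict_rep M N)"
    using finitely_generated_restrict_rep[OF rep N words.subrepresentation_generated[OF N]] .
qed

section \<open>Extending representations of VA to all linear maps\<close>

lemma Ob_VA: "Ob (VA R) = {V. finite_rank_free R V}"
  and Hom_VA: "Hom (VA R) V W = {f \<in> extensional (carrier V). splittable R V W f}"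
  and Ident_VA: "Ident (VA R) V = (\<lambda>x\<in>carrier V. x)"
  and Comp_VA: "Comp (VA R) U V W g f = compose (carrier U) g f"
  by (simp_all add: VA_def)

lemma Hom_VI_subset_VA: "Hom (VI R) V W \<subseteq> Hom (VA R) V W"
  by (auto simp: VI_def)

lemma representation_VI_if_VA:
  assumes "representation K (VA R) M"
  shows "representation K (VI R) M"
proof -
  have eq: "Ob (VI R) = Ob (VA R)" "Ident (VI R) = Ident (VA R)" "Comp (VI R) = Comp (VA R)"
    by (simp_all add: VI_def)
  have sub: "f \<in> Hom (VI R) V W \<Longrightarrow> f \<in> Hom (VA R) V W" for V W f
    using Hom_VI_subset_VA by blast
  show ?thesis
    unfolding representation_def eq
    by (intro conjI ballI impI; rule representationD[OF assms]; assumption?; rule sub)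
qed

lemma subrepresentation_VI_if_VA:
  assumes "subrepresentation K (VA R) M N"
  shows "subrepresentation K (VI R) M N"
  using assms Hom_VI_subset_VA[of R] unfolding subrepresentation_def
  by (simp add: Ob_VA Ob_VI) blast

section \<open>Direct sums and maps into them\<close>

text \<open>Pairs have no canonical place in \<open>'u\<close>, so a direct sum is described by two
  projections that are jointly bijective. The data form one triple so that \<open>act\<close> can
  choose them together.\<close>

definition biproduct ::
    "('r, 'd) ring_scheme \<Rightarrow> ('r, 'u) module \<Rightarrow> ('r, 'u) module \<Rightarrow>
     ('r, 'u) module \<times> ('u \<Rightarrow> 'u) \<times> ('u \<Rightarrow> 'u) \<Rightarrow> bool" where
  "biproduct R V W = (\<lambda>(P, p, q). finite_rank_free R P \<and> linear_map R P V p \<and> linear_map R P W q \<and>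
     p \<in> extensional (carrier P) \<and> q \<in> extensional (carrier P) \<and>
     (\<forall>v\<in>carrier V. \<forall>w\<in>carrier W. \<exists>u\<in>carrier P. p u = v \<and> q u = w) \<and>
     (\<forall>u\<in>carrier P. \<forall>u'\<in>carrier P. p u = p u' \<longrightarrow> q u = q u' \<longrightarrow> u = u'))"

lemma (in finite_cring) biproduct_exists:
  fixes V W :: "('a, 'u::infinite) module"
  assumes "finite_rank_free R V" "finite_rank_free R W"
  shows "\<exists>t. biproduct R V W t"
proof -
  obtain a f1 g1 where 1: "linear_map R V (free_mod R a :: ('a, 'u) module) f1"
    "linear_map R (free_mod R a) V g1" "\<And>x. x \<in> carrier V \<Longrightarrow> g1 (f1 x) = x"
    "\<And>y. y \<in> carrier (free_mod R a) \<Longrightarrow> f1 (g1 y) = y"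
    using free_mod_iso[OF assms(1)] by metis
  obtain b f2 g2 where 2: "linear_map R W (free_mod R b :: ('a, 'u) module) f2"
    "linear_map R (free_mod R b) W g2" "\<And>x. x \<in> carrier W \<Longrightarrow> g2 (f2 x) = x"
    "\<And>y. y \<in> carrier (free_mod R b) \<Longrightarrow> f2 (g2 y) = y"
    using free_mod_iso[OF assms(2)] by metis
  \<comment> \<open>The first \<open>a\<close> coordinates describe \<open>V\<close>, the last
    \<open>b\<close> describe \<open>W\<close>.\<close>
  let ?P = "free_mod R (a + b) :: ('a, 'u) module"
  define p0 :: "'u \<Rightarrow> 'u" where "p0 u = vect R a (coord R (a + b) u)" for u
  define q0 :: "'u \<Rightarrow> 'u" where "q0 u = vect R b (\<lambda>j. coord R (a + b) u (a + j))" for u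
  have p0: "linear_map R ?P (free_mod R a) p0"
    using linear_map_reindex[of a "\<lambda>j. j" "a + b"] by (simp add: p0_def[abs_def])
  have q0: "linear_map R ?P (free_mod R b) q0"
    using linear_map_reindex[of b "\<lambda>j. a + j" "a + b"] by (simp add: q0_def[abs_def])
  have "\<exists>u\<in>carrier ?P. g1 (p0 u) = v \<and> g2 (q0 u) = w" if vw: "v \<in> carrier V" "w \<in> carrier W" for v w
  proof -
    let ?c = "\<lambda>j. if j < a then coord R a (f1 v) j else coord R b (f2 w) (j - a)"
    have f: "f1 v \<in> carrier (free_mod R a)" "f2 w \<in> carrier (free_mod R b)"
      using vw linear_mapD(1)[OF 1(1)] linear_mapD(1)[OF 2(1)] by auto
    then have c: "?c j \<in> carrier R" if "j < a + b" for j
      using that by (auto intro!: coord_closed)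
    let ?u = "vect R (a + b) ?c :: 'u"
    have u: "?u \<in> carrier ?P"
      using c by (rule vect_closed)
    have "p0 ?u = vect R a (coord R a (f1 v))" "q0 ?u = vect R b (coord R b (f2 w))"
      unfolding p0_def q0_def using c by (auto intro!: vect_cong simp: coord_vect)
    then have "p0 ?u = f1 v" "q0 ?u = f2 w"
      using f by (simp_all add: vect_coord)
    with u vw 1(3) 2(3) show ?thesis
      by (intro bexI[of _ ?u]) auto
  qed
  moreover have "u = u'" if u: "u \<in> carrier ?P" "u' \<in> carrier ?P"
    and eq: "g1 (p0 u) = g1 (p0 u')" "g2 (q0 u) = g2 (q0 u')" for u u'
  proof -
    have pq: "p0 u = p0 u'" "q0 u = q0 u'"
      using eq 1(4) 2(4) linear_mapD(1)[OF p0] linear_mapD(1)[OF q0] u by metis+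
    have "coord R (a + b) u j = coord R (a + b) u' j" if "j < a + b" for j
    proof (cases "j < a")
      case True
      have "coord R a (p0 x) j = coord R (a + b) x j" if "x \<in> carrier ?P" for x
        using that True unfolding p0_def by (subst coord_vect) (auto intro!: coord_closed)
      with pq(1) u show ?thesis
        by metis
    next
      case False
      have "coord R b (q0 x) (j - a) = coord R (a + b) x j" if "x \<in> carrier ?P" for x
        using that False \<open>j < a + b\<close> unfolding q0_def
        by (subst coord_vect) (auto intro!: coord_closed)
      with pq(2) u show ?thesis
        by metis
    qed
    with u show ?thesis
      by (intro free_mod_eqI) auto
  qed
  ultimately have "biproduct R V W
      (?P, \<lambda>u\<in>carrier ?P. g1 (p0 u), \<lambda>u\<in>carrier ?P. g2 (q0 u))"
    using linear_map_compose[OF p0 1(2)] linear_map_compose[OF q0 2(2)] finite_rank_free_mod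
      linear_map_cong[OF module_free_mod, of "a + b" "\<lambda>u\<in>carrier ?P. g1 (p0 u)" "\<lambda>u. g1 (p0 u)" V]
      linear_map_cong[OF module_free_mod, of "a + b" "\<lambda>u\<in>carrier ?P. g2 (q0 u)" "\<lambda>u. g2 (q0 u)" W]
    unfolding biproduct_def by simp
  then show ?thesis ..
qed

text \<open>The map into the direct sum with components \<open>f\<close> and \<open>g\<close>. Joint
  injectivity of the projections makes the chosen element unique, and with it the map
  linear.\<close>

definition pairing ::
    "('r, 'u) module \<times> ('u \<Rightarrow> 'u) \<times> ('u \<Rightarrow> 'u) \<Rightarrow> ('r, 'u) module \<Rightarrow> ('u \<Rightarrow> 'u) \<Rightarrow> ('u \<Rightarrow> 'u) \<Rightarrow>
     'u \<Rightarrow> 'u" where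
  "pairing = (\<lambda>(P, p, q) T f g. \<lambda>t\<in>carrier T. SOME u. u \<in> carrier P \<and> p u = f t \<and> q u = g t)"

lemma pairing:
  assumes P: "biproduct R V W (P, p, q)" and T: "module R T"
    and f: "linear_map R T V f" and g: "linear_map R T W g"
  shows "linear_map R T P (pairing (P, p, q) T f g)"
    and "pairing (P, p, q) T f g \<in> extensional (carrier T)"
    and "t \<in> carrier T \<Longrightarrow> p (pairing (P, p, q) T f g t) = f t"
    and "t \<in> carrier T \<Longrightarrow> q (pairing (P, p, q) T f g t) = g t"
proof -
  let ?h = "pairing (P, p, q) T f g"
  interpret T: module R T by fact
  have lin: "linear_map R P V p" "linear_map R P W q" and "finite_rank_free R P"
    and ex: "\<And>v w. v \<in> carrier V \<Longrightarrow> w \<in> carrier W \<Longrightarrow> \<exists>u\<in>carrier P. p u = v \<and> q u = w"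
    and uniq: "\<And>u u'. u \<in> carrier P \<Longrightarrow> u' \<in> carrier P \<Longrightarrow> p u = p u' \<Longrightarrow> q u = q u' \<Longrightarrow> u = u'"
    using P unfolding biproduct_def by auto
  then interpret P: module R P
    by (simp add: finite_rank_free_def)
  have h: "?h t \<in> carrier P \<and> p (?h t) = f t \<and> q (?h t) = g t" if "t \<in> carrier T" for t
  proof -
    have "\<exists>u. u \<in> carrier P \<and> p u = f t \<and> q u = g t"
      using ex[of "f t" "g t"] linear_mapD(1)[OF f that] linear_mapD(1)[OF g that] by blast
    then show ?thesis
      using that someI_ex[of "\<lambda>u. u \<in> carrier P \<and> p u = f t \<and> q u = g t"]
      by (simp add: pairing_def)
  qed
  then show "t \<in> carrier T \<Longrightarrow> p (?h t) = f t" "t \<in> carrier T \<Longrightarrow> q (?h t) = g t"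
    by auto
  show "?h \<in> extensional (carrier T)"
    by (simp add: pairing_def)
  show "linear_map R T P ?h"
    unfolding linear_map_def
  proof (intro conjI ballI funcsetI)
    fix x y assume xy: "x \<in> carrier T" "y \<in> carrier T"
    note hx = h[OF xy(1)] h[OF xy(2)] h[OF T.a_closed[OF xy]]
    show "?h (x \<oplus>\<^bsub>T\<^esub> y) = ?h x \<oplus>\<^bsub>P\<^esub> ?h y"
      by (rule uniq)
        (use hx linear_mapD(2)[OF f xy] linear_mapD(2)[OF g xy]
          linear_mapD(2)[OF lin(1), of "?h x" "?h y"] linear_mapD(2)[OF lin(2), of "?h x" "?h y"]
         in simp_all)
  next
    fix a x assume ax: "a \<in> carrier R" "x \<in> carrier T"
    note hx = h[OF ax(2)] h[OF T.smult_closed[OF ax]]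
    show "?h (a \<odot>\<^bsub>T\<^esub> x) = a \<odot>\<^bsub>P\<^esub> ?h x"
      by (rule uniq)
        (use ax(1) hx linear_mapD(3)[OF f ax] linear_mapD(3)[OF g ax]
          linear_mapD(3)[OF lin(1), of a "?h x"] linear_mapD(3)[OF lin(2), of a "?h x"]
         in simp_all)
  qed (use h in auto)
qed

text \<open>Only the image has to be a summand, and the whole target is one, with zero as
  complement. So projections of direct sums belong to VA, and so do the other surjections
  constructed below.\<close>

lemma splittable_surjection:
  assumes W: "module R W" and f: "linear_map R V W f" "f ` carrier V = carrier W"
  shows "splittable R V W f"
proof -
  interpret W: module R W by fact
  have "submodule {\<zero>\<^bsub>W\<^esub>} R W"
    by (intro W.submoduleI) auto
  moreover have "carrier W <+>\<^bsub>W\<^esub> {\<zero>\<^bsub>W\<^esub>} = carrier W"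
    by (force simp: set_add_def')
  ultimately show ?thesis
    using f W.carrier_is_submodule unfolding splittable_def direct_summand_def
    by (intro conjI exI[of _ "{\<zero>\<^bsub>W\<^esub>}"]) auto
qed

text \<open>The action of an arbitrary linear map \<open>g\<close> from \<open>V\<close> to \<open>W\<close>: factor it through its graph as the
  split injection \<open>v \<mapsto> (v, g v)\<close> followed by the projection \<open>(v, w) \<mapsto> w\<close>.\<close>

definition act ::
    "('r, 'd) ring_scheme \<Rightarrow> (('r, 'u) module, 'u \<Rightarrow> 'u, 'k, 'v) rep_data \<Rightarrow>
     ('r, 'u) module \<Rightarrow> ('r, 'u) module \<Rightarrow> ('u \<Rightarrow> 'u) \<Rightarrow> 'v \<Rightarrow> 'v" where
  "act R M V W g v = (case (SOME t. biproduct R V W t) of (P, p, q) \<Rightarrow>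
     mor M P W q (mor M V P (pairing (P, p, q) V (\<lambda>x. x) g) v))"

context finite_cring
begin

section \<open>Functoriality of the extended action\<close>

lemma biproduct_objects:
  assumes "finite_rank_free R V" "finite_rank_free R W" "biproduct R V W (P, p, q)"
  shows "finite_rank_free R P" "q \<in> Hom (VA R) P W"
    and "linear_map R V W g \<Longrightarrow> pairing (P, p, q) V (\<lambda>x. x) g \<in> Hom (VI R) V P"
proof -
  have V: "module R V" and W: "module R W"
    using assms by (auto simp: finite_rank_free_def)
  show P: "finite_rank_free R P"
    using assms(3) by (simp add: biproduct_def)
  have lin: "linear_map R P V p" "linear_map R P W q"
    and ex: "\<And>v w. v \<in> carrier V \<Longrightarrow> w \<in> carrier W \<Longrightarrow> \<exists>u\<in>carrier P. p u = v \<and> q u = w"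
    and ext: "q \<in> extensional (carrier P)"
    using assms(3) by (auto simp: biproduct_def)
  have "\<zero>\<^bsub>V\<^esub> \<in> carrier V"
    using V by (simp add: module_def abelian_group_def abelian_monoid.zero_closed)
  then have "q ` carrier P = carrier W"
    using linear_mapD(1)[OF lin(2)] ex[of "\<zero>\<^bsub>V\<^esub>"] by auto
  then show "q \<in> Hom (VA R) P W"
    using splittable_surjection[OF W lin(2)] ext by (simp add: Hom_VA)
  show "pairing (P, p, q) V (\<lambda>x. x) g \<in> Hom (VI R) V P" if "linear_map R V W g"
    using pairing[OF assms(3) V linear_map_id that] lin(1)
    by (auto simp: Hom_VI assms(1) P split_injection_def)
qed

text \<open>Splittable maps need not have a splittable composite, so the composite \<open>h\<close>
  is supplied together with its membership in VA.\<close>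

lemma mor_compose_VA:
  assumes "representation K (VA R) M" "finite_rank_free R U" "finite_rank_free R V"
    "finite_rank_free R W" "f \<in> Hom (VA R) U V" "g \<in> Hom (VA R) V W"
    "h \<in> Hom (VA R) U W" "\<And>x. x \<in> carrier U \<Longrightarrow> g (f x) = h x" "v \<in> carrier (obj M U)"
  shows "mor M V W g (mor M U V f v) = mor M U W h v"
proof -
  have "Comp (VA R) U V W g f = h"
    using assms(7,8) unfolding Comp_VA Hom_VA
    by (intro extensionalityI[of _ "carrier U"]) (auto simp: compose_def)
  then show ?thesis
    using representationD(4)[OF assms(1), of U V W f g v] assms by (simp add: Ob_VA)
qed

text \<open>Both factorizations \<open>V \<rightarrow> U \<rightarrow> W\<close> and \<open>V \<rightarrow> V \<oplus> W \<rightarrow> W\<close> of \<open>g\<close> are compared with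
  \<open>V \<rightarrow> U \<oplus> W \<rightarrow> W\<close>.\<close>

lemma mor_mor_eq_act:
  fixes U V W :: "('a, 'u::infinite) module"
  assumes rep: "representation K (VA R) M"
    and V: "finite_rank_free R V" and U: "finite_rank_free R U" and W: "finite_rank_free R W"
    and i: "i \<in> Hom (VI R) V U" and p: "p \<in> Hom (VA R) U W"
    and g: "linear_map R V W g" "\<And>x. x \<in> carrier V \<Longrightarrow> p (i x) = g x"
    and v: "v \<in> carrier (obj M V)"
  shows "mor M U W p (mor M V U i v) = act R M V W g v"
proof -
  obtain P a b where P: "(SOME t. biproduct R V W t) = (P, a, b)"
    by (cases "SOME t. biproduct R V W t")
  have bP: "biproduct R V W (P, a, b)"
    using someI_ex[OF biproduct_exists[OF V W]] P by simp
  obtain Q a' b' where bQ: "biproduct R U W (Q, a', b')"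
    using biproduct_exists[OF U W] by auto
  note Pob = biproduct_objects[OF V W bP] and Qob = biproduct_objects[OF U W bQ]
  have mod: "module R V" "module R U" "module R W" "module R P" "module R Q"
    using V U W Pob(1) Qob(1) by (auto simp: finite_rank_free_def)
  have plin: "linear_map R U W p"
    using p by (simp add: Hom_VA splittable_def)
  obtain r where r: "linear_map R U V r" "\<And>x. x \<in> carrier V \<Longrightarrow> r (i x) = x"
    and ilin: "linear_map R V U i"
    using i by (auto simp: Hom_VI V U split_injection_def)
  have ic: "i x \<in> carrier U" if "x \<in> carrier V" for x
    using linear_mapD(1)[OF ilin that] .
  have bQ': "linear_map R Q U a'" "linear_map R Q W b'"
    and exQ: "\<And>v w. v \<in> carrier U \<Longrightarrow> w \<in> carrier W \<Longrightarrow> \<exists>u\<in>carrier Q. a' u = v \<and> b' u = w"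
    using bQ by (auto simp: biproduct_def)
  have bP': "linear_map R P V a" "linear_map R P W b"
    and uniqP: "\<And>u u'. u \<in> carrier P \<Longrightarrow> u' \<in> carrier P \<Longrightarrow> a u = a u' \<Longrightarrow> b u = b u' \<Longrightarrow> u = u'"
    using bP by (auto simp: biproduct_def)
  define T where "T = pairing (Q, a', b') U (\<lambda>x. x) p"
  have T: "T \<in> Hom (VI R) U Q" "\<And>x. x \<in> carrier U \<Longrightarrow> T x \<in> carrier Q"
    "\<And>x. x \<in> carrier U \<Longrightarrow> a' (T x) = x" "\<And>x. x \<in> carrier U \<Longrightarrow> b' (T x) = p x"
    using Qob(3)[OF plin] pairing[OF bQ mod(2) linear_map_id plin]
      linear_mapD(1)[of R U Q "pairing (Q, a', b') U (\<lambda>x. x) p"] by (auto simp: T_def)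
  define Ti where "Ti = compose (carrier V) T i"
  have Ti: "Ti \<in> Hom (VI R) V Q" "\<And>x. x \<in> carrier V \<Longrightarrow> Ti x = T (i x)"
    using compose_Hom_VI[OF V U Qob(1) i T(1)] by (auto simp: Ti_def compose_def)
  \<comment> \<open>\<open>D\<close> is the map \<open>(u, w) \<mapsto> (r u, w)\<close>, which
    takes \<open>(i x, g x)\<close> to \<open>(x, g x)\<close> and so links the two direct sums. It
    is onto because \<open>r\<close> retracts \<open>i\<close>, hence a morphism of VA.\<close>
  define D where "D = pairing (P, a, b) Q (\<lambda>x. r (a' x)) b'"
  have rlin: "linear_map R Q V (\<lambda>x. r (a' x))"
    using linear_map_compose[OF bQ'(1) r(1)] .
  have D: "linear_map R Q P D" "D \<in> extensional (carrier Q)"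
    "\<And>x. x \<in> carrier Q \<Longrightarrow> a (D x) = r (a' x)" "\<And>x. x \<in> carrier Q \<Longrightarrow> b (D x) = b' x"
    using pairing[OF bP mod(5) rlin bQ'(2)] by (auto simp: D_def)
  have "\<exists>x\<in>carrier Q. D x = u" if u: "u \<in> carrier P" for u
  proof -
    have au: "a u \<in> carrier V" "b u \<in> carrier W"
      using u linear_mapD(1)[OF bP'(1)] linear_mapD(1)[OF bP'(2)] by auto
    then obtain x where x: "x \<in> carrier Q" "a' x = i (a u)" "b' x = b u"
      using exQ ic by blast
    have "D x = u"
      by (rule uniqP)
        (use x(2,3) D(3,4)[OF x(1)] r(2)[OF au(1)] u linear_mapD(1)[OF D(1) x(1)] in simp_all)
    with x(1) show ?thesis by blast
  qed
  then have "D ` carrier Q = carrier P"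
    using linear_mapD(1)[OF D(1)] by blast
  then have DH: "D \<in> Hom (VA R) Q P"
    using splittable_surjection[OF mod(4) D(1)] D(2) by (simp add: Hom_VA)
  define J where "J = pairing (P, a, b) V (\<lambda>x. x) g"
  have J: "J \<in> Hom (VI R) V P" "\<And>x. x \<in> carrier V \<Longrightarrow> J x \<in> carrier P"
    "\<And>x. x \<in> carrier V \<Longrightarrow> a (J x) = x" "\<And>x. x \<in> carrier V \<Longrightarrow> b (J x) = g x"
    using Pob(3)[OF g(1)] pairing[OF bP mod(1) linear_map_id g(1)]
      linear_mapD(1)[of R V P "pairing (P, a, b) V (\<lambda>x. x) g"] by (auto simp: J_def)
  have DJ: "D (Ti x) = J x" if "x \<in> carrier V" for x
    by (rule uniqP)
        (use that Ti(2) T ic D(3,4) J(2-) r(2) g(2) linear_mapD(1)[OF D(1)] in auto)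
  have sub: "f \<in> Hom (VI R) A B \<Longrightarrow> f \<in> Hom (VA R) A B" for f and A B :: "('a, 'u) module"
    using Hom_VI_subset_VA by blast
  have iv: "mor M V U i v \<in> carrier (obj M U)" and Tiv: "mor M V Q Ti v \<in> carrier (obj M Q)"
    using linear_mapD(1)[OF representationD(2)[OF rep _ _ sub[OF i]] v]
      linear_mapD(1)[OF representationD(2)[OF rep _ _ sub[OF Ti(1)]] v] V U Qob(1)
    by (auto simp: Ob_VA)
  \<comment> \<open>Each of the four equalities composes or decomposes two morphisms whose composite
    is already known to lie in VA.\<close>
  have "mor M U W p (mor M V U i v) = mor M Q W b' (mor M U Q T (mor M V U i v))"
    using mor_compose_VA[OF rep U Qob(1) W sub[OF T(1)] Qob(2) p T(4) iv] by simp
  also have "\<dots> = mor M Q W b' (mor M V Q Ti v)"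
    using mor_compose_VA[OF rep V U Qob(1) sub[OF i] sub[OF T(1)] sub[OF Ti(1)] Ti(2)[symmetric] v]
    by simp
  also have "\<dots> = mor M P W b (mor M Q P D (mor M V Q Ti v))"
    using mor_compose_VA[OF rep Qob(1) Pob(1) W DH Pob(2) Qob(2) D(4) Tiv] by simp
  also have "\<dots> = mor M P W b (mor M V P J v)"
    using mor_compose_VA[OF rep V Qob(1) Pob(1) sub[OF Ti(1)] DH sub[OF J(1)] DJ v] by simp
  finally show ?thesis
    by (simp add: act_def P J_def)
qed

lemma act_closed:
  fixes V W :: "('a, 'u::infinite) module"
  assumes rep: "representation K (VA R) M"
    and V: "finite_rank_free R V" and W: "finite_rank_free R W"
    and g: "linear_map R V W g" and v: "v \<in> carrier (obj M V)"
  shows "act R M V W g v \<in> carrier (obj M W)"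
proof -
  obtain P a b where P: "(SOME t. biproduct R V W t) = (P, a, b)"
    by (cases "SOME t. biproduct R V W t")
  then have bP: "biproduct R V W (P, a, b)"
    using someI_ex[OF biproduct_exists[OF V W]] by simp
  note Pob = biproduct_objects[OF V W bP]
  have "pairing (P, a, b) V (\<lambda>x. x) g \<in> Hom (VA R) V P"
    using Pob(3)[OF g] Hom_VI_subset_VA by blast
  then have "mor M V P (pairing (P, a, b) V (\<lambda>x. x) g) v \<in> carrier (obj M P)"
    using linear_mapD(1)[OF representationD(2)[OF rep]] V Pob(1) v by (simp add: Ob_VA)
  then show ?thesis
    using linear_mapD(1)[OF representationD(2)[OF rep]] W Pob(1,2) by (simp add: Ob_VA act_def P)
qed

lemma act_id:
  fixes V :: "('a, 'u::infinite) module"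
  assumes rep: "representation K (VA R) M" and V: "finite_rank_free R V"
    and v: "v \<in> carrier (obj M V)"
  shows "act R M V V (\<lambda>x\<in>carrier V. x) v = v"
proof -
  let ?i = "\<lambda>x\<in>carrier V. x"
  have i: "?i \<in> Hom (VI R) V V"
    using Ident_Hom_VI[OF V] .
  then have "?i \<in> Hom (VA R) V V"
    using Hom_VI_subset_VA by blast
  moreover from i have "linear_map R V V ?i"
    by (simp add: Hom_VI V split_injection_def)
  ultimately have "mor M V V ?i (mor M V V ?i v) = act R M V V ?i v"
    using i v by (intro mor_mor_eq_act[OF rep V V V]) auto
  moreover have "mor M V V ?i v = v"
    using representationD(3)[OF rep, of V v] V v by (simp add: Ob_VA Ident_VA)
  ultimately show ?thesis
    by simp
qed

text \<open>The composite of \<open>h\<close> and \<open>g\<close> may lie outside VA. But the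
  projection \<open>b\<close> is onto, so \<open>h \<circ> b\<close> has the same image as
  \<open>h\<close> and is splittable. This factors \<open>h \<circ> g\<close> as a split injection
  followed by a morphism of VA, and \<open>mor_mor_eq_act\<close> identifies the result with the
  action.\<close>

lemma mor_act:
  fixes U V W :: "('a, 'u::infinite) module"
  assumes rep: "representation K (VA R) M"
    and V: "finite_rank_free R V" and W: "finite_rank_free R W" and U: "finite_rank_free R U"
    and g: "linear_map R V W g" and h: "h \<in> Hom (VA R) W U" and v: "v \<in> carrier (obj M V)"
  shows "mor M W U h (act R M V W g v) = act R M V U (compose (carrier V) h g) v"
proof -
  obtain P a b where P: "(SOME t. biproduct R V W t) = (P, a, b)"
    by (cases "SOME t. biproduct R V W t")
  then have bP: "biproduct R V W (P, a, b)"
    using someI_ex[OF biproduct_exists[OF V W]] by simp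
  note Pob = biproduct_objects[OF V W bP]
  have mod: "module R V" "module R W" "module R U" "module R P"
    using V W U Pob(1) by (auto simp: finite_rank_free_def)
  let ?J = "pairing (P, a, b) V (\<lambda>x. x) g"
  have hlin: "linear_map R W U h" "direct_summand R U (h ` carrier W)"
    using h by (auto simp: Hom_VA splittable_def)
  have b: "linear_map R P W b" "\<And>w. w \<in> carrier W \<Longrightarrow> \<exists>u\<in>carrier P. b u = w"
  proof -
    have "\<zero>\<^bsub>V\<^esub> \<in> carrier V"
      using mod(1) by (simp add: module_def abelian_group_def abelian_monoid.zero_closed)
    then show "linear_map R P W b" "\<And>w. w \<in> carrier W \<Longrightarrow> \<exists>u\<in>carrier P. b u = w"
      using bP unfolding biproduct_def by blast+
  qed
  define hb where "hb = compose (carrier P) h b"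
  have hb: "hb x = h (b x)" if "x \<in> carrier P" for x
    using that by (simp add: hb_def compose_def)
  have "hb ` carrier P = h ` carrier W"
    using hb b(2) linear_mapD(1)[OF b(1)] by (auto simp: image_iff)
  moreover have "linear_map R P U hb"
    using linear_map_compose[OF b(1) hlin(1)] linear_map_cong[OF mod(4), of hb "\<lambda>x. h (b x)"] hb
    by simp
  ultimately have hbH: "hb \<in> Hom (VA R) P U"
    using hlin(2) by (simp add: Hom_VA splittable_def hb_def)
  have J: "?J \<in> Hom (VI R) V P"
    using Pob(3)[OF g] .
  then have J': "?J \<in> Hom (VA R) V P"
    using Hom_VI_subset_VA by blast
  then have Jv: "mor M V P ?J v \<in> carrier (obj M P)"
    using linear_mapD(1)[OF representationD(2)[OF rep]] V Pob(1) v by (simp add: Ob_VA)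
  have lin: "linear_map R V U (compose (carrier V) h g)"
    using linear_map_compose[OF g hlin(1)]
      linear_map_cong[OF mod(1), of "compose (carrier V) h g" "\<lambda>x. h (g x)"]
    by (simp add: compose_def)
  have "mor M W U h (act R M V W g v) = mor M W U h (mor M P W b (mor M V P ?J v))"
    by (simp add: act_def P)
  also have "\<dots> = mor M P U hb (mor M V P ?J v)"
    using mor_compose_VA[OF rep Pob(1) W U Pob(2) h hbH hb[symmetric] Jv] by simp
  also have "\<dots> = act R M V U (compose (carrier V) h g) v"
  proof (rule mor_mor_eq_act[OF rep V Pob(1) U J hbH lin _ v])
    fix x assume x: "x \<in> carrier V"
    then have "?J x \<in> carrier P"
      using linear_mapD(1)[OF pairing(1)[OF bP mod(1) linear_map_id g]] by simp
    with x show "hb (?J x) = compose (carrier V) h g x"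
      using pairing(4)[OF bP mod(1) linear_map_id g x] by (simp add: hb compose_def)
  qed
  finally show ?thesis .
qed

text \<open>\<open>G i W\<close> consists of all linear maps, so that by \<open>mor_act\<close> the
  images of the generators are stable under VA. The finite set found over VI also generates over VA,
  since every subrepresentation over VA is one over VI.\<close>

lemma Rep_noetherian_VA:
  assumes K: "left_noetherian_ring K"
  shows "Rep_noetherian TYPE('v) K (VA R :: (('a, 'u::infinite) module, 'u \<Rightarrow> 'u) cat_data)"
  unfolding Rep_noetherian_def
proof (intro allI impI, elim conjE)
  fix M :: "(('a, 'u) module, 'u \<Rightarrow> 'u, 'c, 'v) rep_data" and N
  assume rep: "representation K (VA R) M" and fg: "finitely_generated_rep K (VA R) M"
    and N: "subrepresentation K (VA R) M N"
  obtain xs where xs: "set xs \<subseteq> (SIGMA x:Ob (VA R). carrier (obj M x))"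
    and gen: "\<And>N x. subrepresentation K (VA R) M N \<Longrightarrow>
      (\<And>i. i < length xs \<Longrightarrow> snd (xs ! i) \<in> N (fst (xs ! i))) \<Longrightarrow>
      x \<in> Ob (VA R) \<Longrightarrow> N x = carrier (obj M x)"
    using finite_generators_list[OF fg] by metis
  define Y where "Y i = fst (xs ! i)" for i
  define v where "v i = snd (xs ! i)" for i
  have Yv: "finite_rank_free R (Y i)" "v i \<in> carrier (obj M (Y i))" if "i < length xs" for i
    using nth_mem[OF that] xs by (auto simp: Y_def v_def Ob_VA)
  define G where "G i W = {g \<in> extensional (carrier (Y i)). linear_map R (Y i) W g}"
    for i and W :: "('a, 'u) module"
  define e where "e i W g = act R M (Y i) W g (v i)" for i W g
  define S where "S W = {e i W g |i g. i < length xs \<and> g \<in> G i W}" for W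
  have Ob: "W \<in> Ob (VA R) \<longleftrightarrow> finite_rank_free R W" for W :: "('a, 'u) module"
    by (simp add: Ob_VA)
  have e_closed: "e i W g \<in> carrier (obj M W)"
    if "i < length xs" "finite_rank_free R W" "g \<in> G i W" for i W g
    using act_closed[OF rep Yv(1)] Yv(2) that by (simp add: e_def G_def)
  have compose_G: "compose (carrier (Y i)) h g \<in> G i U"
    and e_compose: "e i U (compose (carrier (Y i)) h g) = mor M W U h (e i W g)"
    if "i < length xs" "finite_rank_free R W" "finite_rank_free R U" "g \<in> G i W" "h \<in> Hom (VA R) W U"
    for i W U g h
  proof -
    have "linear_map R (Y i) W g" "linear_map R W U h"
      using that by (auto simp: G_def Hom_VA splittable_def)
    moreover have "module R (Y i)"
      using Yv(1)[OF that(1)] by (simp add: finite_rank_free_def)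
    ultimately show "compose (carrier (Y i)) h g \<in> G i U"
      using linear_map_compose[of R "Y i" W g U h] linear_map_cong[of R "Y i" "compose (carrier (Y i)) h g" "\<lambda>x. h (g x)" U]
      by (auto simp: G_def compose_def)
    show "e i U (compose (carrier (Y i)) h g) = mor M W U h (e i W g)"
      using mor_act[OF rep Yv(1) that(2,3) _ that(5) Yv(2)] that(1,4) by (simp add: e_def G_def)
  qed
  have sub: "subrepresentation K (VA R) M (\<lambda>W. lspan K (obj M W) (S W))"
  proof (rule subrepresentation_lspan[OF rep])
    show "S W \<subseteq> carrier (obj M W)" if "W \<in> Ob (VA R)" for W
      using that e_closed by (auto simp: S_def Ob)
    show "mor M W U h s \<in> S U"
      if "W \<in> Ob (VA R)" "U \<in> Ob (VA R)" "h \<in> Hom (VA R) W U" "s \<in> S W" for W U h s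
    proof -
      obtain i g where ig: "i < length xs" "g \<in> G i W" "s = e i W g"
        using \<open>s \<in> S W\<close> by (auto simp: S_def)
      with that show ?thesis
        using compose_G e_compose unfolding S_def Ob by (metis (mono_tags, lifting) mem_Collect_eq)
    qed
  qed
  have "v i \<in> lspan K (obj M (Y i)) (S (Y i))" if i: "i < length xs" for i
  proof -
    have "(\<lambda>x\<in>carrier (Y i). x) \<in> G i (Y i)"
      using Ident_Hom_VI[OF Yv(1)[OF i]] by (auto simp: G_def Hom_VI Yv(1)[OF i] split_injection_def)
    moreover have "v i = e i (Y i) (\<lambda>x\<in>carrier (Y i). x)"
      using act_id[OF rep] Yv[OF i] by (simp add: e_def)
    ultimately have "v i \<in> S (Y i)"
      using i by (auto simp: S_def)
    moreover have "S (Y i) \<subseteq> carrier (obj M (Y i))"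
      using e_closed Yv(1)[OF i] by (auto simp: S_def)
    then have "S (Y i) \<subseteq> lspan K (obj M (Y i)) (S (Y i))"
      using Yv(1)[OF i] Ob by (intro left_module.lspan_superset representationD(1)[OF rep]) auto
    ultimately show ?thesis
      by blast
  qed
  then have span: "lspan K (obj M W) (S W) = carrier (obj M W)" if "finite_rank_free R W" for W
    using gen[OF sub] that by (simp add: Ob Y_def v_def)
  interpret words: spanned_rep R K M "length xs" Y G e
  proof unfold_locales
    show "linear_map R (Y i) W g" "g \<in> extensional (carrier (Y i))"
      if "i < length xs" "finite_rank_free R W" "g \<in> G i W" for i W g
      using that by (auto simp: G_def)
    show "compose (carrier (Y i)) h g \<in> G i U"
      "e i U (compose (carrier (Y i)) h g) = mor M W U h (e i W g)"
      if "i < length xs" "finite_rank_free R W" "finite_rank_free R U" "g \<in> G i W"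
        "h \<in> Hom (VI R) W U" for i W U g h
      using compose_G e_compose that Hom_VI_subset_VA by blast+
  qed (use K representation_VI_if_VA[OF rep] Yv e_closed span in \<open>auto simp: S_def\<close>)
  have Ob_eq: "Ob (VI R) = Ob (VA R)"
    by (simp add: VI_def)
  obtain T where "T \<subseteq> (SIGMA x:Ob (VA R). N x)" "finite T"
    "\<forall>N0. subrepresentation K (VI R) M N0 \<and> (\<forall>(x, v)\<in>T. v \<in> N0 x) \<longrightarrow>
      (\<forall>x\<in>Ob (VA R). N x \<subseteq> N0 x)"
    using words.subrepresentation_generated[OF subrepresentation_VI_if_VA[OF N]] unfolding Ob_eq
    by (elim exE conjE)
  then have "\<exists>T \<subseteq> (SIGMA x:Ob (VA R). N x). finite T \<and>
      (\<forall>N0. subrepresentation K (VA R) M N0 \<and> (\<forall>(x, v)\<in>T. v \<in> N0 x) \<longrightarrow>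
        (\<forall>x\<in>Ob (VA R). N x \<subseteq> N0 x))"
    using subrepresentation_VI_if_VA[of K R M] by (intro exI[of _ T]) simp
  then show "finitely_generated_rep K (VA R) (restrict_rep M N)"
    by (rule finitely_generated_restrict_rep[OF rep N])
qed

end

theorem corollary8p3p3:
  fixes R :: "'r ring" and K :: "'k ring"
  assumes "cring R" and "finite (carrier R)"
    and "left_noetherian_ring K" and "\<one>\<^bsub>K\<^esub> \<noteq> \<zero>\<^bsub>K\<^esub>"
  shows "Rep_noetherian TYPE('v) K (VI R :: (('r, 'u::infinite) module, 'u \<Rightarrow> 'u) cat_data) \<and>
         Rep_noetherian TYPE('v) K (VA R :: (('r, 'u) module, 'u \<Rightarrow> 'u) cat_data)"
proof -
  interpret cring R by fact
  interpret finite_cring R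
    by unfold_locales fact
  show ?thesis
    using Rep_noetherian_VI[OF assms(3)] Rep_noetherian_VA[OF assms(3)] by blast
qed

end
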